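(* For each integer $n\ge2$ and each real $\epsilon$ with $0<\epsilon<\frac{a_n}{2}$, the set $$W_{n,\epsilon}=\Big(L\setminus\bigcup_{l=0}^\infty X_l\Big)\cup\Big(\bigcup_{l=0}^\infty Y_l\Big)\cup M\cup(P_1\cup P_2\cup P_3)$$ is a bounded wavelet set of $L^2(\mathbb R)$ having $0$ as an accumulation point.
   Context: Fourier transform: $\widehat\psi(\xi)=\int_{\mathbb R}\psi(x)e^{-2\pi i x\xi}\,dx$. An orthonormal wavelet is a function $\psi\in L^2(\mathbb R)$ such that $\{2^{j/2}\psi(2^jx-k): j,k\in\mathbb Z\}$ is an orthonormal basis of $L^2(\mathbb R)$. A measurable set $K\subset\mathbb R$ is a wavelet set (of $L^2(\mathbb R)$) if there is an orthonormal wavelet $\psi$ with $|\widehat\psi|=\chi_K$ a.e. For $n\ge2$ put $$a_n=\frac{2^{n-2}}{2^n-1},\quad b_n=\frac{2^{n-1}}{2^n-1},\quad c_n=\frac{2^{n-1}(2^{n-1}-1)}{2^n-1},\quad d_n=\frac{2^{2n-2}}{2^n-1},\quad e_n=\frac{2^{n-1}-1}{2^n-1},$$ $$L=[-d_n,-c_n],\qquad M=[-e_n,-a_n].$$ For $0<\epsilon<\frac{a_n}2$ put $$P_1=\left[\frac{a_n}2+\frac{\epsilon}{2^n},\frac{a_n}2+\epsilon\right],\quad P_2=[a_n+2\epsilon,b_n],\quad P_3=[d_n,d_n+2\epsilon],$$ and define recursively $$X_0=P_1-2^{n-2},\quad Y_0=\frac1{2^n}X_0,\qquad X_l=Y_{l-1}-2^{n-2},\quad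 Y_l=\frac1{2^{n+l}}X_l\quad(l\ge1).$$ Here $S+t$ and $tS$ denote the translate and the dilate of a set $S$ by a real $t$. *)

theory Defs
  imports "HOL-Analysis.Analysis"
begin

section \<open>The space of square-integrable functions on the real line\<close>

text \<open>Elements of \<open>L\<^sup>2(\<real>)\<close> are represented by functions; all notions below are invariant under
  changes on null sets.\<close>

definition square_integrable :: "(real \<Rightarrow> complex) \<Rightarrow> bool" where
  "square_integrable f \<longleftrightarrow>
     f \<in> borel_measurable lebesgue \<and> integrable lebesgue (\<lambda>x. (cmod (f x))\<^sup>2)"

definition L2_inner :: "(real \<Rightarrow> complex) \<Rightarrow> (real \<Rightarrow> complex) \<Rightarrow> complex" where
  "L2_inner f g = (LINT x|lebesgue. f x * cnj (g x))"

text \<open>The squared \<open>L\<^sup>2\<close>-distance, as an extended real: the Bochner integral would give the value 0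
  when the difference is not square-integrable.\<close>

definition L2_dist_sq :: "(real \<Rightarrow> complex) \<Rightarrow> (real \<Rightarrow> complex) \<Rightarrow> ennreal" where
  "L2_dist_sq f g = (\<integral>\<^sup>+ x. ennreal ((cmod (f x - g x))\<^sup>2) \<partial>lebesgue)"

text \<open>An orthonormal basis in the Hilbert space sense: an orthonormal family whose finite linear
  combinations are dense.\<close>

definition L2_orthonormal_basis :: "('i \<Rightarrow> real \<Rightarrow> complex) \<Rightarrow> bool" where
  "L2_orthonormal_basis e \<longleftrightarrow>
     (\<forall>i. square_integrable (e i)) \<and>
     (\<forall>i j. L2_inner (e i) (e j) = (if i = j then 1 else 0)) \<and>
     (\<forall>f. square_integrable f \<longrightarrow>
        (\<forall>\<delta>::real. \<delta> > 0 \<longrightarrow>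
           (\<exists>F c. finite F \<and> L2_dist_sq f (\<lambda>x. \<Sum>i\<in>F. c i * e i x) < ennreal \<delta>)))"

section \<open>The Fourier transform\<close>

definition fourier_integral :: "(real \<Rightarrow> complex) \<Rightarrow> real \<Rightarrow> complex" where
  "fourier_integral f \<xi> =
     (LINT x|lebesgue. f x * exp (- 2 * complex_of_real pi * \<i> * complex_of_real x * complex_of_real \<xi>))"

text \<open>The Fourier transform on \<open>L\<^sup>2(\<real>)\<close> is the continuous extension of the integral transform from
  the dense subspace \<open>L\<^sup>1(\<real>) \<inter> L\<^sup>2(\<real>)\<close>, on which the latter is isometric by Plancherel's theorem.
  The relation says that \<open>g\<close> represents the transform of \<open>f\<close>; it determines \<open>g\<close> up to a null set,
  independently of the approximating sequence.\<close>

definition has_L2_fourier_transform :: "(real \<Rightarrow> complex) \<Rightarrow> (real \<Rightarrow> complex) \<Rightarrow> bool" where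
  "has_L2_fourier_transform f g \<longleftrightarrow>
     square_integrable f \<and> square_integrable g \<and>
     (\<exists>u. (\<forall>m::nat. integrable lebesgue (u m) \<and> square_integrable (u m)) \<and>
          (\<lambda>m. L2_dist_sq (u m) f) \<longlonglongrightarrow> 0 \<and>
          (\<lambda>m. L2_dist_sq (fourier_integral (u m)) g) \<longlonglongrightarrow> 0)"

section \<open>Wavelets and wavelet sets\<close>

definition wavelet_system :: "(real \<Rightarrow> complex) \<Rightarrow> int \<times> int \<Rightarrow> real \<Rightarrow> complex" where
  "wavelet_system \<psi> = (\<lambda>(j, k) x.
     complex_of_real (2 powr (real_of_int j / 2)) * \<psi> (2 powi j * x - real_of_int k))"

definition orthonormal_wavelet :: "(real \<Rightarrow> complex) \<Rightarrow> bool" where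
  "orthonormal_wavelet \<psi> \<longleftrightarrow> square_integrable \<psi> \<and> L2_orthonormal_basis (wavelet_system \<psi>)"

definition wavelet_set :: "real set \<Rightarrow> bool" where
  "wavelet_set K \<longleftrightarrow> K \<in> sets lebesgue \<and>
     (\<exists>\<psi> g. orthonormal_wavelet \<psi> \<and> has_L2_fourier_transform \<psi> g \<and>
        (AE \<xi> in lebesgue. cmod (g \<xi>) = indicator K \<xi>))"

section \<open>The sets \<open>W\<^bsub>n,\<epsilon>\<^esub>\<close>\<close>

text \<open>The definitions are intended for \<open>n \<ge> 2\<close>, where the subtractions in the exponents are exact.\<close>

definition a_end :: "nat \<Rightarrow> real" where "a_end n = 2 ^ (n - 2) / (2 ^ n - 1)"
definition b_end :: "nat \<Rightarrow> real" where "b_end n = 2 ^ (n - 1) / (2 ^ n - 1)"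
definition c_end :: "nat \<Rightarrow> real" where "c_end n = 2 ^ (n - 1) * (2 ^ (n - 1) - 1) / (2 ^ n - 1)"
definition d_end :: "nat \<Rightarrow> real" where "d_end n = 2 ^ (2 * n - 2) / (2 ^ n - 1)"
definition e_end :: "nat \<Rightarrow> real" where "e_end n = (2 ^ (n - 1) - 1) / (2 ^ n - 1)"

definition L_int :: "nat \<Rightarrow> real set" where "L_int n = {- d_end n .. - c_end n}"
definition M_int :: "nat \<Rightarrow> real set" where "M_int n = {- e_end n .. - a_end n}"

definition P1 :: "nat \<Rightarrow> real \<Rightarrow> real set" where
  "P1 n \<epsilon> = {a_end n / 2 + \<epsilon> / 2 ^ n .. a_end n / 2 + \<epsilon>}"
definition P2 :: "nat \<Rightarrow> real \<Rightarrow> real set" where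
  "P2 n \<epsilon> = {a_end n + 2 * \<epsilon> .. b_end n}"
definition P3 :: "nat \<Rightarrow> real \<Rightarrow> real set" where
  "P3 n \<epsilon> = {d_end n .. d_end n + 2 * \<epsilon>}"

function X_set Y_set :: "nat \<Rightarrow> real \<Rightarrow> nat \<Rightarrow> real set" where
  "X_set n \<epsilon> 0 = (\<lambda>x. x - 2 ^ (n - 2)) ` P1 n \<epsilon>"
| "X_set n \<epsilon> (Suc l) = (\<lambda>x. x - 2 ^ (n - 2)) ` Y_set n \<epsilon> l"
| "Y_set n \<epsilon> l = (\<lambda>x. 1 / 2 ^ (n + l) * x) ` X_set n \<epsilon> l"
  by pat_completeness auto
termination
  by (relation "Wellfounded.measure (\<lambda>s. case s of Inl (n, \<epsilon>, l) \<Rightarrow> 2 * l | Inr (n, \<epsilon>, l) \<Rightarrow> 2 * l + 1)") auto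

text \<open>The last equation is unconditional, so it would unfold every \<open>Y_set\<close> when used by the simplifier.\<close>

declare Y_set.simps [simp del]

definition W_set :: "nat \<Rightarrow> real \<Rightarrow> real set" where
  "W_set n \<epsilon> = (L_int n - (\<Union>l. X_set n \<epsilon> l)) \<union> (\<Union>l. Y_set n \<epsilon> l) \<union> M_int n \<union>
     (P1 n \<epsilon> \<union> P2 n \<epsilon> \<union> P3 n \<epsilon>)"

end

theory Submission
  imports Defs
begin

text \<open>A bounded set \<open>K\<close> is a wavelet set as soon as its integer translates and its dilates by powers of 2
both tile the line up to null sets (\<open>wavelet_set_tile\<close>), so the theorem reduces to two tilings.

For this criterion let \<open>\<psi>\<close> be the inverse Fourier transform of the indicator of \<open>K\<close>. Since \<open>K\<close> is
bounded, all Fourier integrals that occur are elementary. On the frequency side the wavelet system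
consists of the exponentials on the dilates of \<open>K\<close>. A translation tile carries the Fourier series of
the unit interval: the fractional part identifies it with \<open>[0,1)\<close>, preserving measure, and does not
change the exponentials (\<open>parseval_tile\<close>). The dilates of \<open>K\<close> then cut the line into pieces
on each of which the corresponding part of the system is an orthonormal basis. Summing the Parseval
identities of the pieces gives \<open>\<Sum> |<f, \<psi>\<^sub>j\<^sub>k>|\<^sup>2 = \<parallel>f\<parallel>\<^sup>2\<close> (\<open>wavelet_parseval\<close>).

The only form of Plancherel's theorem that this needs concerns functions of bounded support, and
it is itself a consequence of Parseval (\<open>plancherel_bounded_support\<close>): if \<open>h\<close> lives on an interval of
length 1, the values of its transform at \<open>x + k\<close> are the Fourier coefficients of \<open>h\<close> times an exponential;
hence the sum over \<open>k\<close> of their squared moduli is \<open>\<parallel>h\<parallel>\<^sup>2\<close> for every \<open>x\<close>, and one integrates over \<open>x\<close> in an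
interval of length 1. Parseval in turn rests on the Stone-Weierstrass theorem on the unit circle.

The tilings are computed with the orbit sums \<open>x \<mapsto> \<Sum>\<^sub>k F(x + k)\<close> and \<open>x \<mapsto> \<Sum>\<^sub>j F(2\<^sup>j x)\<close>, which
are additive in \<open>F\<close> and do not change if a piece of a set is moved by the action. Write \<open>X\<close> and \<open>Y\<close> for
the unions of the \<open>X\<^sub>l\<close> and the \<open>Y\<^sub>l\<close>. By construction \<open>X = (P\<^sub>1 \<union> Y) - 2\<^bsup>n-2\<^esup>\<close>, so under translation the
holes \<open>X\<close> of \<open>L\<close> are paid for by \<open>P\<^sub>1\<close> and \<open>Y\<close>, and what remains is \<open>L\<close>, \<open>M\<close>, \<open>P\<^sub>2\<close>, \<open>P\<^sub>3\<close>, which move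
to the consecutive intervals of \<open>[-a, 1 - a]\<close>. Under dilation \<open>Y\<close> alone replaces \<open>X\<close>, and
\<open>L\<close>, \<open>M\<close>, \<open>P\<^sub>1\<close>, \<open>P\<^sub>2\<close>, \<open>P\<^sub>3\<close> move to the intervals of \<open>[-2a, -a] \<union> [a, 2a]\<close>. This bookkeeping needs
that \<open>X\<close> lies in \<open>L\<close> and that the \<open>Y\<^sub>l\<close> are disjoint; both follow from
\<open>Y\<^sub>l \<subseteq> (-a/2\<^sup>l, -a/2\<^bsup>l+1\<^esup>)\<close>, which also makes 0 an accumulation point.\<close>

section \<open>Orthonormal families in the square-integrable functions of a measure\<close>

definition L2_on :: "'a measure \<Rightarrow> ('a \<Rightarrow> complex) \<Rightarrow> bool" where
  "L2_on M f \<longleftrightarrow> f \<in> borel_measurable M \<and> integrable M (\<lambda>x. (cmod (f x))\<^sup>2)"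

definition inner_on :: "'a measure \<Rightarrow> ('a \<Rightarrow> complex) \<Rightarrow> ('a \<Rightarrow> complex) \<Rightarrow> complex" where
  "inner_on M f g = (LINT x|M. f x * cnj (g x))"

definition norm_sq :: "'a measure \<Rightarrow> ('a \<Rightarrow> complex) \<Rightarrow> real" where
  "norm_sq M f = (LINT x|M. (cmod (f x))\<^sup>2)"

lemma L2_onD:
  assumes "L2_on M f"
  shows "f \<in> borel_measurable M" "integrable M (\<lambda>x. (cmod (f x))\<^sup>2)"
  using assms by (auto simp: L2_on_def)

lemma norm_sq_nonneg: "norm_sq M f \<ge> 0"
  by (simp add: norm_sq_def)

lemma norm_sq_nn_integral:
  assumes "L2_on M f"
  shows "(\<integral>\<^sup>+x. ennreal ((cmod (f x))\<^sup>2) \<partial>M) = ennreal (norm_sq M f)"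
  unfolding norm_sq_def using L2_onD(2)[OF assms] by (intro nn_integral_eq_integral) auto

lemma L2_onI_nn:
  assumes "f \<in> borel_measurable M" "(\<integral>\<^sup>+x. ennreal ((cmod (f x))\<^sup>2) \<partial>M) < \<infinity>"
  shows "L2_on M f"
  unfolding L2_on_def using assms by (auto intro!: integrableI_bounded)

lemma L2_on_cong_AE:
  assumes "L2_on M f" "g \<in> borel_measurable M" "AE x in M. f x = g x"
  shows "L2_on M g"
proof -
  have "(\<integral>\<^sup>+x. ennreal ((cmod (g x))\<^sup>2) \<partial>M) = (\<integral>\<^sup>+x. ennreal ((cmod (f x))\<^sup>2) \<partial>M)"
    using assms(3) by (intro nn_integral_cong_AE) auto
  also have "\<dots> < \<infinity>" using norm_sq_nn_integral[OF assms(1)] by simp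
  finally show ?thesis using assms(2) by (intro L2_onI_nn)
qed

lemma cmod_sum_sq_le: "(cmod (a + b))\<^sup>2 \<le> 2 * (cmod a)\<^sup>2 + 2 * (cmod b)\<^sup>2"
proof -
  have "(cmod (a + b))\<^sup>2 \<le> (cmod a + cmod b)\<^sup>2"
    by (intro power_mono norm_triangle_ineq) auto
  also have "\<dots> \<le> 2 * (cmod a)\<^sup>2 + 2 * (cmod b)\<^sup>2"
    using zero_le_power2[of "cmod a - cmod b"] by (simp add: power2_eq_square algebra_simps)
  finally show ?thesis .
qed

lemma L2_on_mult_left:
  assumes "L2_on M f" shows "L2_on M (\<lambda>x. c * f x)"
  using assms by (auto simp: L2_on_def norm_mult power_mult_distrib)

lemma L2_on_add:
  assumes "L2_on M f" "L2_on M g" shows "L2_on M (\<lambda>x. f x + g x)"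
proof -
  note [measurable] = L2_onD(1)[OF assms(1)] L2_onD(1)[OF assms(2)]
  have "integrable M (\<lambda>x. 2 * (cmod (f x))\<^sup>2 + 2 * (cmod (g x))\<^sup>2)"
    using L2_onD(2)[OF assms(1)] L2_onD(2)[OF assms(2)] by simp
  then have "integrable M (\<lambda>x. (cmod (f x + g x))\<^sup>2)"
    by (rule Bochner_Integration.integrable_bound) (auto simp: cmod_sum_sq_le)
  then show ?thesis by (simp add: L2_on_def)
qed

lemma L2_on_diff:
  assumes "L2_on M f" "L2_on M g" shows "L2_on M (\<lambda>x. f x - g x)"
  using L2_on_add[OF assms(1) L2_on_mult_left[OF assms(2), of "-1"]] by simp

lemma L2_on_zero: "L2_on M (\<lambda>x. 0)"
  by (simp add: L2_on_def)

lemma L2_on_sum: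
  assumes "\<And>i. i \<in> F \<Longrightarrow> L2_on M (e i)" shows "L2_on M (\<lambda>x. \<Sum>i\<in>F. c i * e i x)"
  using assms
  by (induction F rule: infinite_finite_induct) (auto intro!: L2_on_zero L2_on_add L2_on_mult_left)

lemma borel_measurable_cnj [measurable]: "cnj \<in> borel_measurable borel"
  by (intro borel_measurable_continuous_onI continuous_intros)

lemma integrable_L2_product:
  assumes "L2_on M f" "L2_on M g" shows "integrable M (\<lambda>x. f x * cnj (g x))"
proof -
  note [measurable] = L2_onD(1)[OF assms(1)] L2_onD(1)[OF assms(2)]
  have "integrable M (\<lambda>x. (cmod (f x))\<^sup>2 + (cmod (g x))\<^sup>2)"
    using L2_onD(2)[OF assms(1)] L2_onD(2)[OF assms(2)] by simp
  then show ?thesis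
  proof (rule Bochner_Integration.integrable_bound)
    have "cmod (f x * cnj (g x)) \<le> (cmod (f x))\<^sup>2 + (cmod (g x))\<^sup>2" for x
    using zero_le_power2[of "cmod (f x) - cmod (g x)"]
      mult_nonneg_nonneg[OF norm_ge_zero norm_ge_zero, of "f x" "g x"]
    unfolding power2_diff norm_mult complex_mod_cnj by linarith
    then show "AE x in M. norm (f x * cnj (g x)) \<le> norm ((cmod (f x))\<^sup>2 + (cmod (g x))\<^sup>2)"
      by (intro AE_I2) (simp del: norm_mult)
  qed measurable
qed

lemma inner_on_diff_left:
  assumes "L2_on M f" "L2_on M g" "L2_on M h"
  shows "inner_on M (\<lambda>x. f x - g x) h = inner_on M f h - inner_on M g h"
  unfolding inner_on_def
  using integrable_L2_product[OF assms(1,3)] integrable_L2_product[OF assms(2,3)]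
  by (simp add: left_diff_distrib)

lemma inner_on_sum_left:
  assumes "finite F" "\<And>i. i \<in> F \<Longrightarrow> L2_on M (e i)" "L2_on M h"
  shows "inner_on M (\<lambda>x. \<Sum>i\<in>F. c i * e i x) h = (\<Sum>i\<in>F. c i * inner_on M (e i) h)"
proof -
  have "(\<lambda>x. (\<Sum>i\<in>F. c i * e i x) * cnj (h x)) = (\<lambda>x. \<Sum>i\<in>F. c i * (e i x * cnj (h x)))"
    by (simp add: sum_distrib_right mult.assoc)
  then show ?thesis
    unfolding inner_on_def using integrable_L2_product[OF assms(2,3)] by simp
qed

lemma inner_on_self: "inner_on M f f = of_real (norm_sq M f)"
  unfolding inner_on_def norm_sq_def complex_norm_square[symmetric] by (rule integral_complex_of_real)

lemma norm_sq_diff_scaled: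
  assumes "L2_on M f" "L2_on M g"
  shows "norm_sq M (\<lambda>x. f x - c * g x) = norm_sq M f - 2 * Re (cnj c * inner_on M f g) + (cmod c)\<^sup>2 * norm_sq M g"
proof -
  have eq: "(cmod (f x - c * g x))\<^sup>2 =
     (cmod (f x))\<^sup>2 - 2 * Re (cnj c * (f x * cnj (g x))) + (cmod c)\<^sup>2 * (cmod (g x))\<^sup>2" for x
    unfolding cmod_power2 by (simp add: power2_eq_square algebra_simps)
  have I: "integrable M (\<lambda>x. cnj c * (f x * cnj (g x)))"
    using integrable_L2_product[OF assms] by simp
  then have "(LINT x|M. Re (cnj c * (f x * cnj (g x)))) = Re (LINT x|M. cnj c * (f x * cnj (g x)))"
    by (rule integral_Re)
  also have "\<dots> = Re (cnj c * inner_on M f g)"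
    by (simp add: inner_on_def)
  finally have R: "(LINT x|M. Re (cnj c * (f x * cnj (g x)))) = Re (cnj c * inner_on M f g)" .
  have IR: "integrable M (\<lambda>x. Re (cnj c * (f x * cnj (g x))))"
    using I by (rule integrable_Re)
  show ?thesis
    unfolding norm_sq_def eq R[symmetric]
    using IR L2_onD(2)[OF assms(1)] L2_onD(2)[OF assms(2)]
    by (simp del: Re_complex_of_real times_complex.sel)
qed

lemma norm_sq_add_le:
  assumes "L2_on M f" "L2_on M g"
  shows "norm_sq M (\<lambda>x. f x + g x) \<le> 2 * norm_sq M f + 2 * norm_sq M g"
proof -
  note i = L2_onD(2)[OF assms(1)] L2_onD(2)[OF assms(2)] L2_onD(2)[OF L2_on_add[OF assms]]
  have "norm_sq M (\<lambda>x. f x + g x) \<le> (LINT x|M. 2 * (cmod (f x))\<^sup>2 + 2 * (cmod (g x))\<^sup>2)"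
    unfolding norm_sq_def using i by (intro integral_mono) (auto simp: cmod_sum_sq_le)
  also have "\<dots> = 2 * norm_sq M f + 2 * norm_sq M g"
    unfolding norm_sq_def using i by simp
  finally show ?thesis .
qed

definition orthonormal_on :: "'a measure \<Rightarrow> ('i \<Rightarrow> 'a \<Rightarrow> complex) \<Rightarrow> bool" where
  "orthonormal_on M e \<longleftrightarrow>
     (\<forall>i. L2_on M (e i)) \<and> (\<forall>i j. inner_on M (e i) (e j) = (if i = j then 1 else 0))"

text \<open>Best approximation: the last sum is the price of using coefficients other than those of the orthogonal
projection. Both Bessel's inequality and the two Parseval lemmas below are read off from this identity.\<close>

lemma orthonormal_norm_sq_diff_sum:
  assumes e: "orthonormal_on M e" and f: "L2_on M f" and "finite F"
  shows "norm_sq M (\<lambda>x. f x - (\<Sum>i\<in>F. c i * e i x)) =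
    norm_sq M f - (\<Sum>i\<in>F. (cmod (inner_on M f (e i)))\<^sup>2) + (\<Sum>i\<in>F. (cmod (inner_on M f (e i) - c i))\<^sup>2)"
  using \<open>finite F\<close>
proof (induction F rule: finite_induct)
  case empty
  then show ?case by simp
next
  case (insert i F)
  have L2e: "L2_on M (e i)" for i using e by (simp add: orthonormal_on_def)
  have ipe: "inner_on M (e i) (e j) = (if i = j then 1 else 0)" for i j
    using e by (simp add: orthonormal_on_def)
  define g where "g = (\<lambda>x. f x - (\<Sum>i\<in>F. c i * e i x))"
  have Lg: "L2_on M g" unfolding g_def by (intro L2_on_diff f L2_on_sum L2e)
  have ne: "norm_sq M (e i) = 1"
    using inner_on_self[of M "e i"] ipe[of i i] by (metis of_real_1 of_real_eq_iff)
  have "inner_on M g (e i) = inner_on M f (e i) - (\<Sum>j\<in>F. c j * inner_on M (e j) (e i))"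
    unfolding g_def
    by (subst inner_on_diff_left) (auto intro!: f L2e L2_on_sum inner_on_sum_left insert)
  also have "(\<Sum>j\<in>F. c j * inner_on M (e j) (e i)) = 0"
    using insert(2) by (intro sum.neutral) (auto simp: ipe)
  finally have ipg: "inner_on M g (e i) = inner_on M f (e i)" by simp
  have "(\<lambda>x. f x - (\<Sum>i\<in>insert i F. c i * e i x)) = (\<lambda>x. g x - c i * e i x)"
    using insert(1,2) by (auto simp: g_def)
  then have "norm_sq M (\<lambda>x. f x - (\<Sum>i\<in>insert i F. c i * e i x)) =
      norm_sq M g - 2 * Re (cnj (c i) * inner_on M f (e i)) + (cmod (c i))\<^sup>2"
    using norm_sq_diff_scaled[OF Lg L2e] by (simp add: ipg ne)
  also have "\<dots> = norm_sq M g - (cmod (inner_on M f (e i)))\<^sup>2 + (cmod (inner_on M f (e i) - c i))\<^sup>2"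
    unfolding cmod_power2 by (simp add: power2_eq_square algebra_simps)
  finally show ?case
    using insert(1,2) insert.IH by (simp add: g_def)
qed

lemma count_space_finite_sum_le:
  fixes f :: "'i \<Rightarrow> ennreal"
  assumes "finite F" shows "sum f F \<le> (\<integral>\<^sup>+i. f i \<partial>count_space UNIV)"
proof -
  have "sum f F = (\<integral>\<^sup>+i. f i * indicator F i \<partial>count_space UNIV)"
    using assms by (subst nn_integral_count_space'[of F]) auto
  also have "\<dots> \<le> (\<integral>\<^sup>+i. f i \<partial>count_space UNIV)"
    by (intro nn_integral_mono) (auto split: split_indicator)
  finally show ?thesis .
qed

text \<open>Sums of the squared coefficients are written as integrals over counting measures, which may be
exchanged with other integrals. This lemma brings them back to finite sums.\<close>

lemma count_space_approx_finite_sum: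
  fixes f :: "'i::countable \<Rightarrow> ennreal"
  assumes "c < (\<integral>\<^sup>+i. f i \<partial>count_space UNIV)"
  obtains F where "finite F" "c < sum f F"
proof -
  define A where "A n = {i::'i. to_nat i < n}" for n
  have fin: "finite (A n)" for n
    unfolding A_def by (rule finite_imageD[where f=to_nat]) (auto intro: finite_subset[of _ "{..<n}"])
  have "(\<lambda>n. \<integral>\<^sup>+i. f i * indicator (A n) i \<partial>count_space UNIV) \<longlonglongrightarrow> (\<integral>\<^sup>+i. f i \<partial>count_space UNIV)"
  proof (rule nn_integral_LIMSEQ)
    show "incseq (\<lambda>n i. f i * indicator (A n) i)"
      by (auto simp: incseq_def le_fun_def A_def split: split_indicator)
    fix i
    have "eventually (\<lambda>n. f i * indicator (A n) i = f i) sequentially"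
      using eventually_gt_at_top[of "to_nat i"] by eventually_elim (auto simp: A_def)
    then show "(\<lambda>n. f i * indicator (A n) i) \<longlonglongrightarrow> f i"
      by (rule tendsto_eventually)
  qed auto
  from order_tendstoD(1)[OF this assms] obtain n where
    n: "c < (\<integral>\<^sup>+i. f i * indicator (A n) i \<partial>count_space UNIV)"
    by (auto simp: eventually_sequentially)
  also have "\<dots> = sum f (A n)"
    using fin by (subst nn_integral_count_space'[of "A n"]) auto
  finally show ?thesis using fin that by blast
qed

lemma parseval_of_dense:
  fixes e :: "'i::countable \<Rightarrow> 'a \<Rightarrow> complex"
  assumes e: "orthonormal_on M e" and f: "L2_on M f"
    and dense: "\<And>\<delta>::real. \<delta> > 0 \<Longrightarrow> \<exists>F c. finite F \<and> norm_sq M (\<lambda>x. f x - (\<Sum>i\<in>F. c i * e i x)) < \<delta>"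
  shows "(\<integral>\<^sup>+i. ennreal ((cmod (inner_on M f (e i)))\<^sup>2) \<partial>count_space UNIV) = ennreal (norm_sq M f)"
    (is "?S = _")
proof (rule antisym)
  show "?S \<le> ennreal (norm_sq M f)"
  proof (rule ccontr)
    assume "\<not> ?S \<le> ennreal (norm_sq M f)"
    then obtain F where F: "finite F" "ennreal (norm_sq M f) < (\<Sum>i\<in>F. ennreal ((cmod (inner_on M f (e i)))\<^sup>2))"
      using count_space_approx_finite_sum by (metis not_le)
    have "0 \<le> norm_sq M f - (\<Sum>i\<in>F. (cmod (inner_on M f (e i)))\<^sup>2)"
      using orthonormal_norm_sq_diff_sum[OF e f F(1), of "\<lambda>i. inner_on M f (e i)"]
        norm_sq_nonneg[of M "\<lambda>x. f x - (\<Sum>i\<in>F. inner_on M f (e i) * e i x)"] by simp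
    then show False using F(2) by (simp add: sum_nonneg norm_sq_nonneg ennreal_less_iff)
  qed
  show "ennreal (norm_sq M f) \<le> ?S"
  proof (rule ennreal_le_epsilon)
    fix \<delta> :: real assume "\<delta> > 0"
    then obtain F c where F: "finite F" "norm_sq M (\<lambda>x. f x - (\<Sum>i\<in>F. c i * e i x)) < \<delta>"
      using dense by blast
    have "norm_sq M f \<le> (\<Sum>i\<in>F. (cmod (inner_on M f (e i)))\<^sup>2) + \<delta>"
      using orthonormal_norm_sq_diff_sum[OF e f F(1), of c] F(2)
        sum_nonneg[of F "\<lambda>i. (cmod (inner_on M f (e i) - c i))\<^sup>2"] by simp
    then have "ennreal (norm_sq M f) \<le> (\<Sum>i\<in>F. ennreal ((cmod (inner_on M f (e i)))\<^sup>2)) + ennreal \<delta>"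
      using \<open>\<delta> > 0\<close> by (simp add: sum_nonneg flip: ennreal_plus)
    also have "\<dots> \<le> ?S + ennreal \<delta>"
      by (intro add_right_mono count_space_finite_sum_le F)
    finally show "ennreal (norm_sq M f) \<le> ?S + ennreal \<delta>" .
  qed
qed

text \<open>The converse direction works for one function at a time, so that Parseval's identity need only be
verified on a dense class in order to conclude that an orthonormal family is a basis.\<close>

lemma dense_of_parseval:
  fixes e :: "'i::countable \<Rightarrow> 'a \<Rightarrow> complex"
  assumes e: "orthonormal_on M e" and f: "L2_on M f"
    and P: "(\<integral>\<^sup>+i. ennreal ((cmod (inner_on M f (e i)))\<^sup>2) \<partial>count_space UNIV) = ennreal (norm_sq M f)"
    and "(\<delta>::real) > 0"
  obtains F c where "finite F" "norm_sq M (\<lambda>x. f x - (\<Sum>i\<in>F. c i * e i x)) < \<delta>"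
proof (cases "norm_sq M f < \<delta>")
  case True
  then show ?thesis using that[of "{}"] by simp
next
  case False
  have "ennreal (norm_sq M f - \<delta>) < ennreal (norm_sq M f)"
    using False \<open>\<delta> > 0\<close> by (intro ennreal_lessI) auto
  then obtain F where F: "finite F" "ennreal (norm_sq M f - \<delta>) < (\<Sum>i\<in>F. ennreal ((cmod (inner_on M f (e i)))\<^sup>2))"
    using P count_space_approx_finite_sum by metis
  then have "norm_sq M f - \<delta> < (\<Sum>i\<in>F. (cmod (inner_on M f (e i)))\<^sup>2)"
    using False by (simp add: sum_nonneg ennreal_less_iff)
  then have "norm_sq M (\<lambda>x. f x - (\<Sum>i\<in>F. inner_on M f (e i) * e i x)) < \<delta>"
    using orthonormal_norm_sq_diff_sum[OF e f F(1), of "\<lambda>i. inner_on M f (e i)"] by simp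
  with F(1) show ?thesis by (rule that)
qed

section \<open>Completeness of the exponentials on the unit interval\<close>

definition echar :: "real \<Rightarrow> complex" where "echar t = cis (2 * pi * t)"

lemma echar_add: "echar (s + t) = echar s * echar t"
  by (simp add: echar_def cis_mult algebra_simps)

lemma echar_0 [simp]: "echar 0 = 1"
  by (simp add: echar_def)

lemma norm_echar [simp]: "cmod (echar t) = 1"
  by (simp add: echar_def)

lemma cnj_echar: "cnj (echar t) = echar (- t)"
  by (simp add: echar_def cis_cnj)

lemma echar_of_int [simp]: "echar (of_int k) = 1"
  unfolding echar_def by (rule cis_multiple_2pi) simp

lemma continuous_on_echar [continuous_intros]:
  "continuous_on S f \<Longrightarrow> continuous_on S (\<lambda>x. echar (f x))"
  unfolding echar_def by (intro continuous_intros)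

lemma borel_measurable_echar [measurable]: "echar \<in> borel_measurable borel"
  by (intro borel_measurable_continuous_onI continuous_intros)

inductive trig_poly :: "(real \<Rightarrow> complex) \<Rightarrow> bool" where
  zero: "trig_poly (\<lambda>x. 0)"
| add_exp: "trig_poly p \<Longrightarrow> trig_poly (\<lambda>x. p x + c * echar (of_int k * x))"

lemma trig_poly_mult_exp: "trig_poly p \<Longrightarrow> trig_poly (\<lambda>x. c * echar (of_int k * x) * p x)"
proof (induction rule: trig_poly.induct)
  case zero
  then show ?case by (simp add: trig_poly.zero)
next
  case (add_exp p d m)
  from trig_poly.add_exp[OF add_exp.IH, of "c * d" "k + m"]
  show ?case by (simp add: algebra_simps echar_add)
qed

lemma trig_poly_add: "trig_poly p \<Longrightarrow> trig_poly q \<Longrightarrow> trig_poly (\<lambda>x. p x + q x)"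
proof (induction rule: trig_poly.induct)
  case (add_exp p c k)
  from trig_poly.add_exp[OF add_exp.IH[OF add_exp.prems], of c k] show ?case by (simp add: algebra_simps)
qed simp

lemma trig_poly_mult: "trig_poly p \<Longrightarrow> trig_poly q \<Longrightarrow> trig_poly (\<lambda>x. p x * q x)"
proof (induction rule: trig_poly.induct)
  case zero
  show ?case by (simp add: trig_poly.zero)
next
  case (add_exp p c k)
  from trig_poly_add[OF add_exp.IH[OF add_exp.prems] trig_poly_mult_exp[OF add_exp.prems, of c k]]
  show ?case by (simp add: algebra_simps)
qed

lemma trig_poly_const: "trig_poly (\<lambda>x. c)"
  using trig_poly.add_exp[OF trig_poly.zero, of c 0] by simp

lemma trig_poly_sum_representation:
  "trig_poly p \<Longrightarrow> \<exists>F c. finite F \<and> p = (\<lambda>x. \<Sum>k\<in>F. c k * echar (of_int k * x))"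
proof (induction rule: trig_poly.induct)
  case zero
  show ?case by (rule exI[of _ "{}"]) auto
next
  case (add_exp p d m)
  then obtain F c where F: "finite F" "p = (\<lambda>x. \<Sum>k\<in>F. c k * echar (of_int k * x))" by blast
  define c' where "c' k = (if k \<in> F then c k else 0) + (if k = m then d else 0)" for k
  have "(\<Sum>k\<in>insert m F. c' k * echar (of_int k * x)) = p x + d * echar (of_int m * x)" for x
  proof -
    have "(\<Sum>k\<in>insert m F. c' k * echar (of_int k * x)) =
        (\<Sum>k\<in>insert m F. (if k \<in> F then c k * echar (of_int k * x) else 0)) +
        (\<Sum>k\<in>insert m F. (if k = m then d * echar (of_int m * x) else 0))"
      unfolding sum.distrib[symmetric] c'_def by (intro sum.cong) (auto simp: algebra_simps)
    also have "(\<Sum>k\<in>insert m F. (if k \<in> F then c k * echar (of_int k * x) else 0)) = p x"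
      unfolding F(2) using F(1) by (intro sum.mono_neutral_cong_right) auto
    also have "(\<Sum>k\<in>insert m F. (if k = m then d * echar (of_int m * x) else 0)) = d * echar (of_int m * x)"
      using F(1) by (subst sum.delta) auto
    finally show ?thesis .
  qed
  with F(1) show ?case by (intro exI[of _ "insert m F"] exI[of _ c']) auto
qed

lemma trig_poly_Re_Im_echar: "trig_poly (\<lambda>x. of_real (Re (echar x)))" "trig_poly (\<lambda>x. of_real (Im (echar x)))"
proof -
  have t: "trig_poly (\<lambda>x. c * echar (of_int k * x))" for c k
    using trig_poly_mult_exp[OF trig_poly_const[of 1]] by simp
  have "(\<lambda>x. of_real (Re (echar x))) = (\<lambda>x. (1/2) * echar (of_int 1 * x) + (1/2) * echar (of_int (-1) * x))"
    by (auto simp: complex_eq_iff simp flip: cnj_echar)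
  then show "trig_poly (\<lambda>x. of_real (Re (echar x)))"
    by (simp only: trig_poly_add[OF t t])
  have "(\<lambda>x. of_real (Im (echar x))) = (\<lambda>x. (-\<i>/2) * echar (of_int 1 * x) + (\<i>/2) * echar (of_int (-1) * x))"
    by (auto simp: complex_eq_iff simp flip: cnj_echar)
  then show "trig_poly (\<lambda>x. of_real (Im (echar x)))"
    by (simp only: trig_poly_add[OF t t])
qed

text \<open>On the circle, real polynomials in the real and imaginary part are trigonometric polynomials, because
\<open>cos\<close> and \<open>sin\<close> are combinations of two exponentials and the exponentials are closed under products.
This is what the Stone-Weierstrass theorem for polynomial functions requires.\<close>

lemma trig_poly_real_polynomial:
  "real_polynomial_function g \<Longrightarrow> trig_poly (\<lambda>x. of_real (g (echar x)))"
proof (induction rule: real_polynomial_function.induct)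
  case (linear h)
  interpret bounded_linear h by fact
  have "h z = Re z * h 1 + Im z * h \<i>" for z
  proof -
    have "h z = h (Re z *\<^sub>R 1 + Im z *\<^sub>R \<i>)"
      by (rule arg_cong[of _ _ h]) (simp add: complex_eq_iff)
    also have "\<dots> = Re z * h 1 + Im z * h \<i>"
      by (simp only: add scaleR) simp
    finally show ?thesis .
  qed
  then have "(\<lambda>x. of_real (h (echar x)) :: complex) =
      (\<lambda>x. of_real (Re (echar x)) * of_real (h 1) + of_real (Im (echar x)) * of_real (h \<i>))"
    by (metis of_real_add of_real_mult)
  moreover have "trig_poly \<dots>"
    by (intro trig_poly_add trig_poly_mult trig_poly_const trig_poly_Re_Im_echar)
  ultimately show ?case by simp
qed (auto intro: trig_poly_const trig_poly_add trig_poly_mult)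

lemma trig_poly_polynomial_function:
  assumes "polynomial_function (g :: complex \<Rightarrow> complex)" shows "trig_poly (\<lambda>x. g (echar x))"
proof -
  have "real_polynomial_function (Re \<circ> g)" "real_polynomial_function (Im \<circ> g)"
    using assms bounded_linear_Re bounded_linear_Im by (auto simp: polynomial_function_def)
  from this[THEN trig_poly_real_polynomial]
  have "trig_poly (\<lambda>x. of_real (Re (g (echar x))) + \<i> * of_real (Im (g (echar x))))"
    by (intro trig_poly_add trig_poly_mult trig_poly_const) auto
  then show ?thesis by (simp add: complex_eq[symmetric])
qed

text \<open>A continuous function on \<open>[0,1]\<close> with equal end values factors through the circle as a continuous
function, since the exponential is a quotient map from the compact interval; there it is
approximated by a polynomial.\<close>

lemma periodic_continuous_approx_trig_poly:
  fixes f :: "real \<Rightarrow> complex"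
  assumes f: "continuous_on {0..1} f" and per: "f 0 = f 1" and "\<epsilon> > 0"
  obtains p where "trig_poly p" "\<And>x. x \<in> {0..1} \<Longrightarrow> cmod (f x - p x) < \<epsilon>"
proof -
  define F where "F z = f (Arg2pi z / (2 * pi))" for z
  have Fee: "F (echar x) = f x" if "x \<in> {0..1}" for x
  proof (cases "x = 1")
    case True
    have "echar 1 = 1" using echar_of_int[of 1] by simp
    then have "Arg2pi (echar x) = 0" using True by (simp add: Arg2pi_eq_0)
    then show ?thesis using per True by (simp add: F_def)
  next
    case False
    then have "Arg2pi (echar x) = 2 * pi * x"
      using that unfolding echar_def cis_conv_exp by (subst Arg2pi_exp) auto
    then show ?thesis by (simp add: F_def)
  qed
  have im: "echar ` {0..1} = sphere 0 1"
  proof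
    show "sphere 0 1 \<subseteq> echar ` {0..1}"
    proof
      fix z :: complex assume "z \<in> sphere 0 1"
      then have "z = echar (Arg2pi z / (2*pi))"
        using Arg2pi_eq[of z] by (simp add: echar_def cis_conv_exp)
      moreover have "Arg2pi z / (2*pi) \<in> {0..1}"
        using Arg2pi_ge_0[of z] Arg2pi_lt_2pi[of z] by simp
      ultimately show "z \<in> echar ` {0..1}" by blast
    qed
  qed auto
  have "continuous_on (sphere 0 1) F"
    unfolding continuous_on_open_gen[OF order_refl[THEN image_subset_iff_funcset[THEN iffD1]]]
  proof (intro allI impI)
    fix U assume U: "openin (top_of_set (F ` sphere 0 1)) U"
    have img: "f ` {0..1} = F ` sphere 0 1"
      unfolding im[symmetric] image_image using Fee by (intro image_cong) auto
    have "openin (top_of_set {0..1}) ({0..1} \<inter> f -` U)"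
      using f U unfolding img[symmetric] by (metis continuous_on_open)
    also have "{0..1} \<inter> f -` U = {0..1} \<inter> echar -` (sphere 0 1 \<inter> F -` U)"
      using Fee im by auto
    finally show "openin (top_of_set (sphere 0 1)) (sphere 0 1 \<inter> F -` U)"
      by (subst (asm) Abstract_Topology_2.continuous_imp_quotient_map[OF _ im]) (auto intro: continuous_intros)
  qed
  from Stone_Weierstrass_polynomial_function[OF compact_sphere this \<open>\<epsilon> > 0\<close>]
  obtain g where g: "polynomial_function g" "\<And>z. z \<in> sphere 0 1 \<Longrightarrow> cmod (F z - g z) < \<epsilon>"
    by auto
  show ?thesis
  proof (rule that[OF trig_poly_polynomial_function[OF g(1)]])
    fix x :: real assume "x \<in> {0..1}"
    then show "cmod (f x - g (echar x)) < \<epsilon>" using g(2)[of "echar x"] Fee by simp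
  qed
qed

abbreviation unit_measure :: "real measure" where
  "unit_measure \<equiv> restrict_space lborel {0..<1}"

lemma unit_measure_finite: "finite_measure unit_measure"
  by (rule finite_measureI) (simp add: emeasure_restrict_space space_restrict_space)

lemma unit_measure_space:
  "measure unit_measure (space unit_measure) = 1" "measure unit_measure {0..<1} = 1"
  by (simp_all add: measure_def emeasure_restrict_space space_restrict_space)

lemma unit_measure_measurable: "f \<in> borel_measurable borel \<Longrightarrow> f \<in> borel_measurable unit_measure"
  by (simp add: measurable_restrict_space1)

lemma integral_exp_unit:
  "(LINT x|unit_measure. echar (of_int k * x)) = (if k = 0 then 1 else 0)"
proof (cases "k = 0")
  case True
  interpret finite_measure unit_measure by (rule unit_measure_finite)
  show ?thesis using True by (simp add: unit_measure_space)
next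
  case False
  define c where "c = 2 * of_real pi * \<i> * of_int k"
  have c: "c \<noteq> 0" using False by (simp add: c_def)
  have echar: "echar (of_int k * x) = exp (c * of_real x)" for x
    by (simp add: echar_def cis_conv_exp c_def algebra_simps)
  have "(LINT x|unit_measure. echar (of_int k * x)) = (LINT x:{0..<1}|lborel. echar (of_int k * x))"
    by (simp add: set_lebesgue_integral_def integral_restrict_space)
  also have "\<dots> = (LBINT x:{0..1}. echar (of_int k * x))"
    unfolding set_lebesgue_integral_def
    by (intro integral_cong_AE) (auto intro!: AE_I[of _ _ "{1}"] split: split_indicator)
  also have "\<dots> = (LBINT x:{0..1}. exp (c * of_real x))"
    by (simp add: echar)
  also have "\<dots> = exp (c * of_real 1) / c - exp (c * of_real 0) / c"
    unfolding set_lebesgue_integral_def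
  proof (rule integral_FTC_Icc)
    fix x :: real
    have "((\<lambda>x. exp (c * x) / c) has_field_derivative exp (c * of_real x)) (at (of_real x))"
      using c by (auto intro!: derivative_eq_intros)
    then show "((\<lambda>x. exp (c * of_real x) / c) has_vector_derivative exp (c * of_real x)) (at x within {0..1})"
      by (rule has_vector_derivative_real_field)
  qed (auto intro!: continuous_intros)
  also have "\<dots> = 0"
    using echar[of 1] by simp
  finally show ?thesis using False by simp
qed

lemma orthonormal_exp_unit: "orthonormal_on unit_measure (\<lambda>k::int. \<lambda>x. echar (of_int k * x))"
proof -
  interpret finite_measure unit_measure by (rule unit_measure_finite)
  have "inner_on unit_measure (\<lambda>x. echar (of_int k * x)) (\<lambda>x. echar (of_int m * x)) = (if k = m then 1 else 0)" for k m
  proof -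
    have "echar (of_int k * x) * cnj (echar (of_int m * x)) = echar (of_int (k - m) * x)" for x
      by (simp add: cnj_echar echar_add[symmetric] algebra_simps)
    then show ?thesis by (simp add: inner_on_def integral_exp_unit del: of_int_diff)
  qed
  then show ?thesis
    by (simp add: orthonormal_on_def L2_on_def unit_measure_measurable)
qed

text \<open>The approximation goes through three steps: cut off the large values of \<open>f\<close>; approximate the bounded
function almost everywhere by continuous functions that vanish at both end points; approximate these
uniformly by trigonometric polynomials.\<close>

lemma exp_dense_unit:
  assumes f: "L2_on unit_measure f" and "\<delta> > 0"
  shows "\<exists>p. trig_poly p \<and> norm_sq unit_measure (\<lambda>x. f x - p x) < \<delta>"
proof -
  interpret finite_measure unit_measure by (rule unit_measure_finite)
  note [measurable] = L2_onD(1)[OF f]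
  define h where "h n x = (if cmod (f x) \<le> real n then f x else 0)" for n x
  have hm [measurable]: "h n \<in> borel_measurable unit_measure" for n
    unfolding h_def by measurable
  have "(\<lambda>n. norm_sq unit_measure (\<lambda>x. f x - h n x)) \<longlonglongrightarrow> (LINT x|unit_measure. 0)"
    unfolding norm_sq_def
  proof (rule integral_dominated_convergence[where w = "\<lambda>x. (cmod (f x))\<^sup>2"])
    show "AE x in unit_measure. (\<lambda>n. (cmod (f x - h n x))\<^sup>2) \<longlonglongrightarrow> 0"
    proof (rule AE_I2)
      fix x
      obtain N where "cmod (f x) \<le> real N" using real_arch_simple by blast
      then have "eventually (\<lambda>n. (cmod (f x - h n x))\<^sup>2 = 0) sequentially"
        unfolding h_def by (intro eventually_sequentiallyI[of N]) auto
      then show "(\<lambda>n. (cmod (f x - h n x))\<^sup>2) \<longlonglongrightarrow> 0" by (rule tendsto_eventually)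
    qed
  qed (use f in \<open>auto simp: h_def L2_on_def\<close>)
  then have "eventually (\<lambda>n. norm_sq unit_measure (\<lambda>x. f x - h n x) < \<delta> / 8) sequentially"
    using \<open>\<delta> > 0\<close> by (intro order_tendstoD(2)) auto
  then obtain N where N: "norm_sq unit_measure (\<lambda>x. f x - h N x) < \<delta> / 8"
    by (auto simp: eventually_sequentially)
  define B where "B = real N + 1"
  have B: "B > 0" "\<And>x. cmod (h N x) \<le> B" by (auto simp: B_def h_def)
  define h' where "h' x = indicator {0..<1} x *\<^sub>R h N x" for x
  have "h' \<in> borel_measurable borel"
    using hm[of N] unfolding h'_def
    by (subst (asm) borel_measurable_restrict_space_iff) auto
  then have "h' measurable_on UNIV"
    by (intro lebesgue_measurable_imp_measurable_on) (auto intro: measurable_completion)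
  then obtain Z g where Z: "negligible Z" and g: "\<And>n. continuous_on UNIV (g n)"
    "\<And>x. x \<notin> Z \<Longrightarrow> (\<lambda>n::nat. g n x) \<longlonglongrightarrow> h' x"
    unfolding measurable_on_def by auto
  \<comment> \<open>Radial projection onto the disc of radius \<open>B\<close>: it keeps the approximants bounded, so that dominated convergence applies.\<close>
  define cl where "cl z = z / of_real (max 1 (cmod z / B))" for z :: complex
  have cl: "cmod (cl z) \<le> B" for z
    unfolding cl_def using B(1) by (simp add: norm_divide field_simps max_def)
  have clid: "cl z = z" if "cmod z \<le> B" for z
    unfolding cl_def using that B(1) by (simp add: max_def field_simps)
  have clc: "continuous_on UNIV cl"
    unfolding cl_def using B(1)
    by (intro continuous_intros) (auto simp: max_def)
  \<comment> \<open>The first factor vanishes at 0 and 1 and tends to 1 in between.\<close>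
  define q where "q n x = of_real (min 1 (real n * (x * (1 - x)))) * cl (g n x)" for n x
  have qc: "continuous_on UNIV (q n)" for n
    unfolding q_def
    by (intro continuous_intros continuous_on_compose2[OF clc] g(1)) auto
  have [measurable]: "q n \<in> borel_measurable unit_measure" for n
    by (intro unit_measure_measurable borel_measurable_continuous_onI qc)
  have qB: "cmod (q n x) \<le> B" if "x \<in> {0..<1}" for n x
  proof -
    have "cmod (q n x) = \<bar>min 1 (real n * (x * (1 - x)))\<bar> * cmod (cl (g n x))"
      unfolding q_def by (simp only: norm_mult norm_of_real)
    also have "\<dots> \<le> 1 * B"
      using that cl by (intro mult_mono) auto
    finally show ?thesis by simp
  qed
  have hL: "L2_on unit_measure (h N)"
    unfolding L2_on_def using B
    by (auto intro!: integrable_const_bound[where B="B^2"] power_mono)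
  have qL: "L2_on unit_measure (q n)" for n
    unfolding L2_on_def using qB
    by (auto intro!: integrable_const_bound[where B="B^2"] power_mono AE_I2)
  have "(\<lambda>n. norm_sq unit_measure (\<lambda>x. h N x - q n x)) \<longlonglongrightarrow> (LINT x|unit_measure. 0)"
    unfolding norm_sq_def
  proof (rule integral_dominated_convergence[where w = "\<lambda>x. (B + B)\<^sup>2"])
    have "AE x in lebesgue. x \<notin> Z"
      using Z by (intro AE_not_in) (simp add: negligible_iff_null_sets)
    then have "AE x in lborel. x \<notin> Z"
      by (simp add: AE_completion_iff)
    then have "AE x in lborel. x \<in> {0..<1} \<longrightarrow> (\<lambda>n. (cmod (h N x - q n x))\<^sup>2) \<longlonglongrightarrow> 0"
      using AE_lborel_singleton[of 0]
    proof eventually_elim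
      case (elim x)
      show ?case
      proof
        assume x: "x \<in> {0..<1}"
        with elim have x0: "x * (1 - x) > 0" by auto
        obtain M where M: "1 / (x * (1 - x)) \<le> real M" using real_arch_simple by blast
        have "eventually (\<lambda>n. q n x = cl (g n x)) sequentially"
        proof (rule eventually_sequentiallyI[of M])
          fix n assume "M \<le> n"
          then have "1 / (x * (1 - x)) \<le> real n" using M by linarith
          then have "1 \<le> real n * (x * (1 - x))" using x0 by (simp add: divide_le_eq)
          then show "q n x = cl (g n x)" by (simp add: q_def min_def)
        qed
        moreover have "(\<lambda>n. cl (g n x)) \<longlonglongrightarrow> cl (h' x)"
          using g(2)[of x] elim clc
          by (intro isCont_tendsto_compose[of "h' x" cl]) (auto simp: continuous_on_eq_continuous_at)
        moreover have "cl (h' x) = h N x"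
          using x B by (simp add: h'_def clid)
        ultimately have "(\<lambda>n. q n x) \<longlonglongrightarrow> h N x"
          by (simp add: tendsto_cong)
        then have "(\<lambda>n. (cmod (h N x - q n x))\<^sup>2) \<longlonglongrightarrow> (cmod (h N x - h N x))\<^sup>2"
          by (intro tendsto_intros)
        then show "(\<lambda>n. (cmod (h N x - q n x))\<^sup>2) \<longlonglongrightarrow> 0" by simp
      qed
    qed
    then show "AE x in unit_measure. (\<lambda>n. (cmod (h N x - q n x))\<^sup>2) \<longlonglongrightarrow> 0"
      by (subst AE_restrict_space_iff) auto
    show "AE x in unit_measure. norm ((cmod (h N x - q n x))\<^sup>2) \<le> (B + B)\<^sup>2" for n
    proof (rule AE_I2)
      fix x assume "x \<in> space unit_measure"
      then have "cmod (q n x) \<le> B" using qB by (simp add: space_restrict_space)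
      then have "cmod (h N x - q n x) \<le> B + B"
        using B(2)[of x] norm_triangle_ineq4[of "h N x" "q n x"] by linarith
      then show "norm ((cmod (h N x - q n x))\<^sup>2) \<le> (B + B)\<^sup>2"
        using power_mono[of "cmod (h N x - q n x)" "B + B" 2] by simp
    qed
  qed auto
  then have "eventually (\<lambda>n. norm_sq unit_measure (\<lambda>x. h N x - q n x) < \<delta> / 16) sequentially"
    using \<open>\<delta> > 0\<close> by (intro order_tendstoD(2)) auto
  then obtain n where n: "norm_sq unit_measure (\<lambda>x. h N x - q n x) < \<delta> / 16"
    by (auto simp: eventually_sequentially)
  define \<eta> where "\<eta> = sqrt (\<delta> / 16)"
  have \<eta>: "\<eta> > 0" "\<eta>\<^sup>2 = \<delta> / 16" using \<open>\<delta> > 0\<close> by (auto simp: \<eta>_def)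
  have "q n 0 = q n 1" by (simp add: q_def)
  then obtain p where p: "trig_poly p" "\<And>x. x \<in> {0..1} \<Longrightarrow> cmod (q n x - p x) < \<eta>"
    using periodic_continuous_approx_trig_poly[OF continuous_on_subset[OF qc subset_UNIV] _ \<eta>(1)] by metis
  have pL: "L2_on unit_measure p"
  proof -
    obtain F c where "p = (\<lambda>x. \<Sum>k\<in>F. c k * echar (of_int k * x))"
      using trig_poly_sum_representation[OF p(1)] by blast
    then show ?thesis
      using orthonormal_exp_unit unfolding orthonormal_on_def by (auto intro: L2_on_sum)
  qed
  have "norm_sq unit_measure (\<lambda>x. q n x - p x) \<le> (LINT x|unit_measure. \<eta>\<^sup>2)"
    unfolding norm_sq_def
  proof (rule integral_mono)
    show "integrable unit_measure (\<lambda>x. (cmod (q n x - p x))\<^sup>2)"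
      using L2_on_diff[OF qL pL] by (simp add: L2_on_def)
    fix x assume "x \<in> space unit_measure"
    then show "(cmod (q n x - p x))\<^sup>2 \<le> \<eta>\<^sup>2"
      using p(2)[of x] by (intro power_mono) (auto simp: space_restrict_space)
  qed simp
  then have 1: "norm_sq unit_measure (\<lambda>x. q n x - p x) \<le> \<delta> / 16" using \<eta>(2) by (simp add: unit_measure_space)
  have 2: "norm_sq unit_measure (\<lambda>x. (h N x - q n x) + (q n x - p x)) < \<delta> / 4"
    using norm_sq_add_le[OF L2_on_diff[OF hL qL] L2_on_diff[OF qL pL], of n n] n 1 by linarith
  have "norm_sq unit_measure (\<lambda>x. (f x - h N x) + (h N x - p x)) < \<delta>"
    using norm_sq_add_le[OF L2_on_diff[OF f hL] L2_on_diff[OF hL pL]] N 2 \<open>\<delta> > 0\<close> by simp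
  then show ?thesis using p(1) by auto
qed

lemma parseval_unit:
  assumes "L2_on unit_measure f"
  shows "(\<integral>\<^sup>+k. ennreal ((cmod (inner_on unit_measure f (\<lambda>x. echar (of_int k * x))))\<^sup>2) \<partial>count_space (UNIV :: int set)) =
    ennreal (norm_sq unit_measure f)"
proof (rule parseval_of_dense[OF orthonormal_exp_unit assms])
  fix \<delta> :: real assume "\<delta> > 0"
  then obtain p where p: "trig_poly p" "norm_sq unit_measure (\<lambda>x. f x - p x) < \<delta>"
    using exp_dense_unit[OF assms] by blast
  then show "\<exists>F c. finite F \<and> norm_sq unit_measure (\<lambda>x. f x - (\<Sum>k\<in>F. c k * echar (of_int k * x))) < \<delta>"
    using trig_poly_sum_representation by metis
qed

section \<open>Fourier series on translation tiles\<close>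

definition trans_tile :: "real set \<Rightarrow> bool" where
  "trans_tile K \<longleftrightarrow> K \<in> sets borel \<and> (AE x in lborel. \<exists>!k::int. x + of_int k \<in> K)"

lemma trans_tile_borel: "trans_tile K \<Longrightarrow> K \<in> sets borel"
  by (simp add: trans_tile_def)

lemma count_space_indicator_ex1:
  assumes "\<exists>!i. f i \<in> A"
  shows "(\<integral>\<^sup>+i. indicator A (f i) \<partial>count_space UNIV) = (1::ennreal)"
proof -
  obtain i where i: "\<And>j. f j \<in> A \<longleftrightarrow> j = i" using assms by blast
  have "indicator A (f j) = (indicator {i} j :: ennreal)" for j
    using i[of j] by (simp add: indicator_def)
  then show ?thesis by (simp only: nn_integral_indicator) simp
qed

lemma ex1_translate_half_open: "\<exists>!k::int. x + of_int k \<in> {a..<a + 1::real}"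
proof -
  obtain c where c: "c = \<lceil>a - x\<rceil>" by blast
  then have "of_int c - 1 < a - x" "a - x \<le> of_int c"
    using ceiling_correct[of "a - x"] by auto
  then have "x + of_int c \<in> {a..<a + 1}" by auto
  moreover have "k = c" if "x + of_int k \<in> {a..<a + 1}" for k
  proof -
    from that have "of_int k - 1 < a - x" "a - x \<le> of_int k" by auto
    then show "k = c" unfolding c by (rule ceiling_unique[symmetric])
  qed
  ultimately show ?thesis by blast
qed

lemma trans_tile_half_open: "trans_tile {a..<a + 1}"
  using ex1_translate_half_open by (simp add: trans_tile_def)

lemma nn_integral_shift:
  assumes "F \<in> borel_measurable borel"
  shows "(\<integral>\<^sup>+x. F (x + t) \<partial>lborel) = (\<integral>\<^sup>+x. F x \<partial>(lborel :: real measure))"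
  using nn_integral_real_affine[OF assms, of 1 t] by (simp add: add.commute)

text \<open>Insert \<open>1 = \<Sum>\<^sub>k indicator K (x + k)\<close> and substitute in each summand.\<close>

lemma nn_integral_tile_unfold:
  fixes F :: "real \<Rightarrow> ennreal"
  assumes K: "trans_tile K" and [measurable]: "F \<in> borel_measurable borel"
  shows "(\<integral>\<^sup>+x. F x \<partial>lborel) =
    (\<integral>\<^sup>+x. (\<integral>\<^sup>+k. F (x + of_int k) \<partial>count_space (UNIV :: int set)) * indicator K x \<partial>lborel)"
proof -
  note [measurable] = trans_tile_borel[OF K]
  have "(\<integral>\<^sup>+x. F x \<partial>lborel) =
      (\<integral>\<^sup>+x. (\<integral>\<^sup>+k. F x * indicator K (x + of_int k) \<partial>count_space (UNIV :: int set)) \<partial>lborel)"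
    using K unfolding trans_tile_def
    by (intro nn_integral_cong_AE)
       (auto simp: nn_integral_cmult count_space_indicator_ex1)
  also have "\<dots> = (\<integral>\<^sup>+k. (\<integral>\<^sup>+x. F x * indicator K (x + of_int k) \<partial>lborel) \<partial>count_space (UNIV :: int set))"
    by (rule nn_integral_count_space_nn_integral) auto
  also have "\<dots> = (\<integral>\<^sup>+k. (\<integral>\<^sup>+x. F (x - of_int k) * indicator K x \<partial>lborel) \<partial>count_space (UNIV :: int set))"
  proof (rule nn_integral_cong)
    fix k :: int
    show "(\<integral>\<^sup>+x. F x * indicator K (x + of_int k) \<partial>lborel) = (\<integral>\<^sup>+x. F (x - of_int k) * indicator K x \<partial>lborel)"
      using nn_integral_shift[of "\<lambda>x. F (x - of_int k) * indicator K x" "of_int k"] by simp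
  qed
  also have "\<dots> = (\<integral>\<^sup>+k. (\<integral>\<^sup>+x. F (x - of_int (- k)) * indicator K x \<partial>lborel) \<partial>count_space (UNIV :: int set))"
    by (rule nn_integral_bij_count_space[symmetric]) (auto intro!: bij_betwI[where g=uminus])
  also have "\<dots> = (\<integral>\<^sup>+x. (\<integral>\<^sup>+k. F (x - of_int (- k)) * indicator K x \<partial>count_space (UNIV :: int set)) \<partial>lborel)"
    by (rule nn_integral_count_space_nn_integral[symmetric]) auto
  also have "\<dots> = (\<integral>\<^sup>+x. (\<integral>\<^sup>+k. F (x + of_int k) \<partial>count_space (UNIV :: int set)) * indicator K x \<partial>lborel)"
    by (simp add: nn_integral_multc)
  finally show ?thesis .
qed

lemma frac_add_int: "frac (x + of_int k) = frac x"
  by (simp add: frac_def)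

lemma borel_measurable_frac [measurable]: "(frac :: real \<Rightarrow> real) \<in> borel_measurable borel"
  unfolding frac_def by measurable

lemma nn_integral_tile_frac:
  fixes G :: "real \<Rightarrow> ennreal"
  assumes K: "trans_tile K" and [measurable]: "G \<in> borel_measurable borel"
  shows "(\<integral>\<^sup>+x. G (frac x) * indicator K x \<partial>lborel) = (\<integral>\<^sup>+x. G x * indicator {0..<1} x \<partial>lborel)"
proof -
  note [measurable] = trans_tile_borel[OF K]
  have "(\<integral>\<^sup>+x. G (frac x) * indicator K x \<partial>lborel) = (\<integral>\<^sup>+x. (\<integral>\<^sup>+k. G (frac (x + of_int k)) * indicator K (x + of_int k)
      \<partial>count_space (UNIV :: int set)) * indicator {0..<1} x \<partial>lborel)"
    using nn_integral_tile_unfold[OF trans_tile_half_open[of 0], of "\<lambda>x. G (frac x) * indicator K x"] by simp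
  also have "\<dots> = (\<integral>\<^sup>+x. G x * indicator {0..<1} x \<partial>lborel)"
  proof (rule nn_integral_cong_AE)
    from K have "AE x in lborel. \<exists>!k::int. x + of_int k \<in> K" by (simp add: trans_tile_def)
    then show "AE x in lborel. (\<integral>\<^sup>+k. G (frac (x + of_int k)) * indicator K (x + of_int k)
      \<partial>count_space (UNIV :: int set)) * indicator {0..<1} x = G x * indicator {0..<1} x"
    proof eventually_elim
      case (elim x)
      then show ?case
        by (auto simp: frac_add_int nn_integral_cmult count_space_indicator_ex1 frac_eq split: split_indicator)
    qed
  qed
  finally show ?thesis .
qed

text \<open>The fractional part maps any translation tile onto the unit interval in a measure preserving way.
All integrals of periodic functions over a tile thus agree with those over the unit interval.\<close>

lemma distr_tile_frac:
  assumes K: "trans_tile K"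
  shows "distr (restrict_space lborel K) borel frac = distr unit_measure borel (\<lambda>x. x)"
proof (rule measure_eqI)
  fix A :: "real set" assume "A \<in> sets (distr (restrict_space lborel K) borel frac)"
  then have [measurable]: "A \<in> sets borel" by simp
  note [measurable] = trans_tile_borel[OF K]
  have m1: "frac \<in> restrict_space lborel K \<rightarrow>\<^sub>M borel" and m2: "(\<lambda>x. x) \<in> unit_measure \<rightarrow>\<^sub>M borel"
    by (intro measurable_restrict_space1; simp)+
  have "emeasure (distr (restrict_space lborel K) borel frac) A =
      (\<integral>\<^sup>+x. indicator A x \<partial>distr (restrict_space lborel K) borel frac)"
    by simp
  also have "\<dots> = (\<integral>\<^sup>+x. indicator A (frac x) * indicator K x \<partial>lborel)"
    using m1 by (subst nn_integral_distr) (auto simp: nn_integral_restrict_space)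
  also have "\<dots> = (\<integral>\<^sup>+x. indicator A x * indicator {0..<1} x \<partial>lborel)"
    by (rule nn_integral_tile_frac[OF K]) simp
  also have "\<dots> = (\<integral>\<^sup>+x. indicator A x \<partial>distr unit_measure borel (\<lambda>x. x))"
    using m2 by (subst nn_integral_distr) (auto simp: nn_integral_restrict_space)
  also have "\<dots> = emeasure (distr unit_measure borel (\<lambda>x. x)) A"
    by simp
  finally show "emeasure (distr (restrict_space lborel K) borel frac) A = emeasure (distr unit_measure borel (\<lambda>x. x)) A" .
qed simp

lemma integral_tile_frac:
  fixes G :: "real \<Rightarrow> 'b::{banach, second_countable_topology}"
  assumes K: "trans_tile K" and [measurable]: "G \<in> borel_measurable borel"
  shows "(LINT x|restrict_space lborel K. G (frac x)) = (LINT x|unit_measure. G x)"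
    and "integrable (restrict_space lborel K) (\<lambda>x. G (frac x)) \<longleftrightarrow> integrable unit_measure G"
proof -
  have m1: "frac \<in> restrict_space lborel K \<rightarrow>\<^sub>M borel" and m2: "(\<lambda>x. x) \<in> unit_measure \<rightarrow>\<^sub>M borel"
    by (intro measurable_restrict_space1; simp)+
  show "(LINT x|restrict_space lborel K. G (frac x)) = (LINT x|unit_measure. G x)"
    using integral_distr[OF m1 assms(2)] integral_distr[OF m2 assms(2)] distr_tile_frac[OF K] by simp
  show "integrable (restrict_space lborel K) (\<lambda>x. G (frac x)) \<longleftrightarrow> integrable unit_measure G"
    using integrable_distr_eq[OF m1 assms(2)] integrable_distr_eq[OF m2 assms(2)] distr_tile_frac[OF K] by simp
qed

lemma echar_int_frac: "echar (of_int k * frac x) = echar (of_int k * x)"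
proof -
  have "echar (of_int k * x) = echar (of_int k * frac x + of_int (k * \<lfloor>x\<rfloor>))"
    by (simp add: frac_def algebra_simps)
  also have "\<dots> = echar (of_int k * frac x)"
    by (simp only: echar_add echar_of_int) simp
  finally show ?thesis by simp
qed

lemma orthonormal_exp_tile:
  assumes "trans_tile K"
  shows "inner_on (restrict_space lborel K) (\<lambda>x. echar (of_int k * x)) (\<lambda>x. echar (of_int m * x)) = (if k = m then 1 else 0)"
proof -
  have "inner_on (restrict_space lborel K) (\<lambda>x. echar (of_int k * x)) (\<lambda>x. echar (of_int m * x)) =
        (LINT x|restrict_space lborel K. echar (of_int k * frac x) * cnj (echar (of_int m * frac x)))"
    by (simp add: inner_on_def echar_int_frac)
  also have "\<dots> = inner_on unit_measure (\<lambda>x. echar (of_int k * x)) (\<lambda>x. echar (of_int m * x))"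
    unfolding inner_on_def by (rule integral_tile_frac[OF assms]) simp
  also have "\<dots> = (if k = m then 1 else 0)"
    using orthonormal_exp_unit by (simp add: orthonormal_on_def)
  finally show ?thesis .
qed

text \<open>The fractional part is injective on a tile up to null sets, so every function on the tile factors
through it. Boundedness turns the inverse of this map into a finite case distinction, and
\<open>H\<close> into an explicit finite sum.\<close>

lemma tile_factor_frac:
  fixes h :: "real \<Rightarrow> complex"
  assumes K: "trans_tile K" "bounded K" and [measurable]: "h \<in> borel_measurable borel"
  obtains H where "H \<in> borel_measurable borel" "AE x in restrict_space lborel K. h x = H (frac x)"
proof -
  note [measurable] = trans_tile_borel[OF K(1)]
  obtain R where R: "\<And>x. x \<in> K \<Longrightarrow> \<bar>x\<bar> \<le> R"
    using K(2) by (auto simp: bounded_iff)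
  define N where "N = \<lceil>R\<rceil> + 1"
  define H where "H y = (\<Sum>k\<in>{-N..N}. h (y + of_int k) * indicator K (y + of_int k))" for y
  have "AE x in lborel. \<exists>!k::int. x + of_int k \<in> K"
    using K(1) by (simp add: trans_tile_def)
  then have "AE x in lborel. x \<in> K \<longrightarrow> h x = H (frac x)"
  proof eventually_elim
    case (elim x)
    show ?case
    proof
      assume x: "x \<in> K"
      have uniq: "k = \<lfloor>x\<rfloor>" if "frac x + of_int k \<in> K" for k
      proof -
        have "x + of_int (k - \<lfloor>x\<rfloor>) \<in> K" "x + of_int 0 \<in> K"
          using that x by (auto simp: frac_def algebra_simps)
        then have "k - \<lfloor>x\<rfloor> = 0" using elim by blast
        then show ?thesis by simp
      qed
      have "\<lfloor>x\<rfloor> \<in> {-N..N}"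
        using R[OF x] unfolding N_def by (auto; linarith)
      moreover have "h (frac x + of_int k) * indicator K (frac x + of_int k) = 0" if "k \<noteq> \<lfloor>x\<rfloor>" for k
        using uniq that by (auto split: split_indicator)
      then have "(\<Sum>k\<in>{-N..N} - {\<lfloor>x\<rfloor>}. h (frac x + of_int k) * indicator K (frac x + of_int k)) = 0"
        by (intro sum.neutral ballI) blast
      ultimately have "H (frac x) = h (frac x + of_int \<lfloor>x\<rfloor>) * indicator K (frac x + of_int \<lfloor>x\<rfloor>)"
        unfolding H_def by (subst sum.remove[of _ "\<lfloor>x\<rfloor>"]) simp_all
      also have "frac x + of_int \<lfloor>x\<rfloor> = x" by (simp add: frac_def)
      finally show "h x = H (frac x)" using x by simp
    qed
  qed
  then have "AE x in restrict_space lborel K. h x = H (frac x)"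
    by (subst AE_restrict_space_iff) auto
  moreover have "H \<in> borel_measurable borel" unfolding H_def by measurable
  ultimately show ?thesis by (intro that)
qed

lemma parseval_tile:
  fixes h :: "real \<Rightarrow> complex"
  assumes K: "trans_tile K" "bounded K" and h [measurable]: "h \<in> borel_measurable borel"
    and L: "L2_on (restrict_space lborel K) h"
  shows "(\<integral>\<^sup>+k. ennreal ((cmod (inner_on (restrict_space lborel K) h (\<lambda>x. echar (of_int k * x))))\<^sup>2)
      \<partial>count_space (UNIV :: int set)) = ennreal (norm_sq (restrict_space lborel K) h)"
proof -
  obtain H where H [measurable]: "H \<in> borel_measurable borel"
    and ae: "AE x in restrict_space lborel K. h x = H (frac x)"
    using tile_factor_frac[OF K h] .
  have [measurable]: "f \<in> borel_measurable (restrict_space lborel K)" if "f \<in> borel_measurable borel" for f :: "real \<Rightarrow> complex"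
    using that by (intro measurable_restrict_space1) simp
  have "L2_on (restrict_space lborel K) (\<lambda>x. H (frac x))"
    by (rule L2_on_cong_AE[OF L _ ae]) measurable
  then have LH: "L2_on unit_measure H"
    using integral_tile_frac(2)[OF K(1), of "\<lambda>x. (cmod (H x))\<^sup>2"]
    by (simp add: L2_on_def unit_measure_measurable)
  have inner_on: "inner_on (restrict_space lborel K) h (\<lambda>x. echar (of_int k * x)) = inner_on unit_measure H (\<lambda>x. echar (of_int k * x))" for k
  proof -
    have "inner_on (restrict_space lborel K) h (\<lambda>x. echar (of_int k * x)) =
        (LINT x|restrict_space lborel K. H (frac x) * cnj (echar (of_int k * frac x)))"
      unfolding inner_on_def using ae by (intro integral_cong_AE) (auto simp: echar_int_frac)
    also have "\<dots> = inner_on unit_measure H (\<lambda>x. echar (of_int k * x))"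
      unfolding inner_on_def by (rule integral_tile_frac[OF K(1)]) simp
    finally show ?thesis .
  qed
  have nrm: "norm_sq (restrict_space lborel K) h = norm_sq unit_measure H"
  proof -
    have "norm_sq (restrict_space lborel K) h = (LINT x|restrict_space lborel K. (cmod (H (frac x)))\<^sup>2)"
      unfolding norm_sq_def using ae by (intro integral_cong_AE) auto
    also have "\<dots> = norm_sq unit_measure H"
      unfolding norm_sq_def by (rule integral_tile_frac[OF K(1)]) simp
    finally show ?thesis .
  qed
  show ?thesis unfolding inner_on nrm by (rule parseval_unit[OF LH])
qed

lemma nn_integral_int_uminus:
  "(\<integral>\<^sup>+k. f (- k) \<partial>count_space (UNIV :: int set)) = (\<integral>\<^sup>+k. f k \<partial>count_space UNIV)"
  by (rule nn_integral_bij_count_space) (auto intro!: bij_betwI[where g=uminus])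

section \<open>Plancherel for functions of bounded support\<close>

definition inv_fourier :: "(real \<Rightarrow> complex) \<Rightarrow> real \<Rightarrow> complex" where
  "inv_fourier h x = (LINT \<xi>|lborel. h \<xi> * echar (x * \<xi>))"

definition fourier :: "(real \<Rightarrow> complex) \<Rightarrow> real \<Rightarrow> complex" where
  "fourier f \<xi> = (LINT x|lborel. f x * echar (- (x * \<xi>)))"

lemma fourier_eq_inv_fourier: "fourier f \<xi> = inv_fourier f (- \<xi>)"
  by (simp add: fourier_def inv_fourier_def mult.commute)

lemma borel_measurable_inv_fourier [measurable]:
  assumes [measurable]: "h \<in> borel_measurable borel" shows "inv_fourier h \<in> borel_measurable borel"
  unfolding inv_fourier_def by measurable

lemma borel_measurable_fourier [measurable]:
  assumes [measurable]: "h \<in> borel_measurable borel" shows "fourier h \<in> borel_measurable borel"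
  unfolding fourier_def by measurable

text \<open>At \<open>x + k\<close> the transform of \<open>h\<close> is a Fourier coefficient of \<open>h\<close> times the exponential of frequency \<open>x\<close>.
By Parseval the squared moduli sum over \<open>k\<close> to the squared norm of \<open>h\<close>, whatever \<open>x\<close> is.\<close>

lemma plancherel_unit_support:
  assumes h [measurable]: "h \<in> borel_measurable borel" and L: "L2_on lborel h"
    and supp: "\<And>x. x \<notin> {-1/2..<1/2} \<Longrightarrow> h x = 0"
  shows "(\<integral>\<^sup>+x. ennreal ((cmod (inv_fourier h x))\<^sup>2) \<partial>lborel) = ennreal (norm_sq lborel h)"
proof -
  define I :: "real set" where "I = {-1/2..<1/2}"
  have I: "trans_tile I" "bounded I" "I \<in> sets borel"
    using trans_tile_half_open[of "-1/2"] by (auto simp: I_def bounded_iff intro!: exI[of _ 1])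
  have sp: "h x = indicator I x *\<^sub>R h x" for x
    using supp by (auto simp: I_def split: split_indicator)
  have to_I: "(LINT \<xi>|restrict_space lborel I. h \<xi> * g \<xi>) = (LINT \<xi>|lborel. h \<xi> * g \<xi>)" for g
  proof -
    have "(LINT \<xi>|restrict_space lborel I. h \<xi> * g \<xi>) = (LINT \<xi>|lborel. indicator I \<xi> *\<^sub>R (h \<xi> * g \<xi>))"
      using I(3) by (simp add: integral_restrict_space)
    also have "\<dots> = (LINT \<xi>|lborel. h \<xi> * g \<xi>)"
      by (intro Bochner_Integration.integral_cong refl) (metis sp mult_scaleR_left)
    finally show ?thesis .
  qed
  have inner: "(\<integral>\<^sup>+k. ennreal ((cmod (inv_fourier h (x + of_int k)))\<^sup>2) \<partial>count_space (UNIV :: int set)) = ennreal (norm_sq lborel h)" for x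
  proof -
    \<comment> \<open>Modulation by frequency \<open>x\<close> turns the transform at \<open>x + k\<close> into the coefficient of index \<open>- k\<close>.\<close>
    define g where "g \<xi> = h \<xi> * echar (x * \<xi>)" for \<xi>
    have [measurable]: "g \<in> borel_measurable borel" unfolding g_def by measurable
    have cg: "cmod (g \<xi>) = cmod (h \<xi>)" for \<xi> by (simp add: g_def norm_mult)
    have nI: "indicator I \<xi> * (cmod (h \<xi>))\<^sup>2 = (cmod (h \<xi>))\<^sup>2" for \<xi>
      using supp by (auto simp: I_def split: split_indicator)
    have Lg: "L2_on (restrict_space lborel I) g"
      using L I(3) unfolding L2_on_def cg
      by (auto simp: integrable_restrict_space nI measurable_restrict_space1)
    have ng: "norm_sq (restrict_space lborel I) g = norm_sq lborel h"
      unfolding norm_sq_def cg using I(3) by (simp add: integral_restrict_space nI)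
    have inner_on: "inner_on (restrict_space lborel I) g (\<lambda>\<xi>. echar (of_int (- k) * \<xi>)) = inv_fourier h (x + of_int k)" for k
      unfolding inner_on_def inv_fourier_def g_def to_I[symmetric]
      by (simp add: cnj_echar echar_add[symmetric] algebra_simps)
    have "ennreal (norm_sq lborel h) = (\<integral>\<^sup>+k. ennreal ((cmod (inner_on (restrict_space lborel I) g (\<lambda>\<xi>. echar (of_int k * \<xi>))))\<^sup>2)
      \<partial>count_space (UNIV :: int set))"
      using parseval_tile[OF I(1,2) _ Lg] ng by simp
    also have "\<dots> = (\<integral>\<^sup>+k. ennreal ((cmod (inner_on (restrict_space lborel I) g (\<lambda>\<xi>. echar (of_int (- k) * \<xi>))))\<^sup>2)
      \<partial>count_space (UNIV :: int set))"
      by (rule nn_integral_int_uminus[symmetric])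
    finally show ?thesis unfolding inner_on by simp
  qed
  have "(\<integral>\<^sup>+x. ennreal ((cmod (inv_fourier h x))\<^sup>2) \<partial>lborel) = (\<integral>\<^sup>+x. ennreal (norm_sq lborel h) * indicator I x \<partial>lborel)"
    by (subst nn_integral_tile_unfold[OF I(1)]) (simp_all add: inner)
  also have "\<dots> = ennreal (norm_sq lborel h)"
    by (simp add: nn_integral_cmult_indicator I(3)) (simp add: I_def)
  finally show ?thesis .
qed

text \<open>A dilation reduces this to supports in an interval of length 1.\<close>

theorem plancherel_bounded_support:
  assumes h [measurable]: "h \<in> borel_measurable borel" and L: "L2_on lborel h"
    and supp: "\<And>x. \<bar>x\<bar> > R \<Longrightarrow> h x = 0"
  shows "L2_on lborel (inv_fourier h)" "norm_sq lborel (inv_fourier h) = norm_sq lborel h"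
proof -
  define N where "N = 2 * \<bar>R\<bar> + 1"
  have N: "N > 0" by (simp add: N_def)
  define g where "g \<xi> = h (N * \<xi>)" for \<xi>
  have [measurable]: "g \<in> borel_measurable borel" unfolding g_def by measurable
  have gi: "integrable lborel (\<lambda>x. (cmod (g x))\<^sup>2)"
    using lborel_integrable_real_affine[of "\<lambda>x. (cmod (h x))\<^sup>2" N 0] L N by (simp add: g_def L2_on_def)
  then have Lg: "L2_on lborel g" by (simp add: L2_on_def)
  have ng: "norm_sq lborel h = N * norm_sq lborel g"
    unfolding norm_sq_def g_def using N
    by (subst lborel_integral_real_affine[where c=N and t=0]) auto
  have "g x = 0" if "x \<notin> {-1/2..<1/2}" for x
  proof -
    from that consider "x \<ge> 1/2" | "-x \<ge> 1/2" by fastforce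
    then have "\<bar>x\<bar> \<ge> 1/2" by cases auto
    then have "N * (1/2) \<le> N * \<bar>x\<bar>" using N by (intro mult_left_mono) auto
    moreover have "\<bar>N * x\<bar> = N * \<bar>x\<bar>" using N by (simp add: abs_mult)
    moreover have "N * (1/2) > R" unfolding N_def by simp
    ultimately have "\<bar>N * x\<bar> > R" by linarith
    then show ?thesis unfolding g_def by (rule supp)
  qed
  then have P: "(\<integral>\<^sup>+x. ennreal ((cmod (inv_fourier g x))\<^sup>2) \<partial>lborel) = ennreal (norm_sq lborel g)"
    by (intro plancherel_unit_support Lg) auto
  have "inv_fourier h x = N *\<^sub>R inv_fourier g (N * x)" for x
    unfolding inv_fourier_def g_def using N
    by (subst lborel_integral_real_affine[where c=N and t=0]) (auto simp: algebra_simps)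
  then have "cmod (inv_fourier h x) = N * cmod (inv_fourier g (N * x))" for x using N by simp
  then have "(\<integral>\<^sup>+x. ennreal ((cmod (inv_fourier h x))\<^sup>2) \<partial>lborel) = (\<integral>\<^sup>+x. ennreal (N\<^sup>2) * ennreal ((cmod (inv_fourier g (N * x)))\<^sup>2) \<partial>lborel)"
    by (simp add: power_mult_distrib ennreal_mult)
  also have "\<dots> = N * (N * (\<integral>\<^sup>+x. ennreal ((cmod (inv_fourier g (N * x)))\<^sup>2) \<partial>lborel))"
    using N by (simp add: nn_integral_cmult power2_eq_square ennreal_mult mult.assoc)
  also have "N * (\<integral>\<^sup>+x. ennreal ((cmod (inv_fourier g (N * x)))\<^sup>2) \<partial>lborel) = (\<integral>\<^sup>+x. ennreal ((cmod (inv_fourier g x))\<^sup>2) \<partial>lborel)"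
    using N by (subst (2) nn_integral_real_affine[where c=N and t=0]) auto
  also have "N * \<dots> = ennreal (norm_sq lborel h)"
    unfolding P ng using N by (simp add: ennreal_mult norm_sq_nonneg)
  finally have F: "(\<integral>\<^sup>+x. ennreal ((cmod (inv_fourier h x))\<^sup>2) \<partial>lborel) = ennreal (norm_sq lborel h)" .
  show LL: "L2_on lborel (inv_fourier h)"
    by (rule L2_onI_nn) (auto simp: F)
  show "norm_sq lborel (inv_fourier h) = norm_sq lborel h"
    using F norm_sq_nn_integral[OF LL] by (simp add: norm_sq_nonneg)
qed

lemma fourier_plancherel:
  assumes f [measurable]: "f \<in> borel_measurable borel" and L: "L2_on lborel f"
    and supp: "\<And>x. \<bar>x\<bar> > R \<Longrightarrow> f x = 0"
  shows "L2_on lborel (fourier f)" "norm_sq lborel (fourier f) = norm_sq lborel f"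
proof -
  note P = plancherel_bounded_support[OF f L supp]
  have eq: "fourier f = (\<lambda>\<xi>. inv_fourier f (0 + (-1) * \<xi>))" by (simp add: fun_eq_iff fourier_eq_inv_fourier)
  show "L2_on lborel (fourier f)"
    using lborel_integrable_real_affine[of "\<lambda>\<xi>. (cmod (inv_fourier f \<xi>))\<^sup>2" "-1" 0] P(1)
    unfolding L2_on_def eq by auto
  have "norm_sq lborel (fourier f) = norm_sq lborel (inv_fourier f)"
    unfolding norm_sq_def eq
    using lborel_integral_real_affine[of "-1" "\<lambda>\<xi>. (cmod (inv_fourier f \<xi>))\<^sup>2" 0] by simp
  with P(2) show "norm_sq lborel (fourier f) = norm_sq lborel f" by simp
qed

definition truncation :: "nat \<Rightarrow> (real \<Rightarrow> complex) \<Rightarrow> real \<Rightarrow> complex" where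
  "truncation m f x = indicator {- real m..real m} x * f x"

text \<open>Truncations approximate \<open>f\<close>, and the error is the difference of the squared norms because the truncation
is an orthogonal projection.\<close>

lemma L2_truncation:
  assumes f [measurable]: "f \<in> borel_measurable borel" and L: "L2_on lborel f"
  shows "truncation m f \<in> borel_measurable borel" "L2_on lborel (truncation m f)" "\<bar>x\<bar> > real m \<Longrightarrow> truncation m f x = 0"
    "norm_sq lborel (\<lambda>x. truncation m f x - f x) = norm_sq lborel f - norm_sq lborel (truncation m f)"
    "(\<lambda>m. norm_sq lborel (truncation m f)) \<longlonglongrightarrow> norm_sq lborel f"
proof -
  note i = L2_onD(2)[OF L]
  have sq: "(cmod (truncation m f x))\<^sup>2 = indicator {- real m..real m} x * (cmod (f x))\<^sup>2" for m x
    by (auto simp: truncation_def split: split_indicator)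
  show m: "truncation m f \<in> borel_measurable borel" for m unfolding truncation_def by measurable
  have iu: "integrable lborel (\<lambda>x. (cmod (truncation m f x))\<^sup>2)" for m
    unfolding sq by (rule Bochner_Integration.integrable_bound[OF i]) (auto split: split_indicator)
  then show "L2_on lborel (truncation m f)" using m by (simp add: L2_on_def)
  show "\<bar>x\<bar> > real m \<Longrightarrow> truncation m f x = 0" by (auto simp: truncation_def split: split_indicator)
  have "(cmod (truncation m f x - f x))\<^sup>2 = (cmod (f x))\<^sup>2 - (cmod (truncation m f x))\<^sup>2" for x
    by (auto simp: truncation_def split: split_indicator)
  then show "norm_sq lborel (\<lambda>x. truncation m f x - f x) = norm_sq lborel f - norm_sq lborel (truncation m f)"
    using i iu by (simp add: norm_sq_def)
  show "(\<lambda>m. norm_sq lborel (truncation m f)) \<longlonglongrightarrow> norm_sq lborel f"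
    unfolding norm_sq_def
  proof (rule integral_dominated_convergence[OF _ _ i])
    show "AE x in lborel. (\<lambda>m. (cmod (truncation m f x))\<^sup>2) \<longlonglongrightarrow> (cmod (f x))\<^sup>2"
    proof (rule AE_I2)
      fix x
      obtain N where N: "\<bar>x\<bar> \<le> real N" using real_arch_simple by blast
      have "eventually (\<lambda>m. (cmod (truncation m f x))\<^sup>2 = (cmod (f x))\<^sup>2) sequentially"
        using N by (intro eventually_sequentiallyI[of N]) (auto simp: sq split: split_indicator)
      then show "(\<lambda>m. (cmod (truncation m f x))\<^sup>2) \<longlonglongrightarrow> (cmod (f x))\<^sup>2" by (rule tendsto_eventually)
    qed
    show "AE x in lborel. norm ((cmod (truncation m f x))\<^sup>2) \<le> (cmod (f x))\<^sup>2" for m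
      by (auto simp: sq split: split_indicator)
  qed (use m in auto)
qed

lemma L2_bounded_support_integrable:
  fixes h :: "real \<Rightarrow> complex"
  assumes h [measurable]: "h \<in> borel_measurable borel" and L: "L2_on lborel h"
    and supp: "\<And>x. \<bar>x\<bar> > R \<Longrightarrow> h x = 0"
  shows "integrable lborel h"
proof (rule Bochner_Integration.integrable_bound)
  show "integrable lborel (\<lambda>x. (cmod (h x))\<^sup>2 + indicator {-R..R} x)"
    using L unfolding L2_on_def
    by (intro Bochner_Integration.integrable_add integrable_real_indicator) (auto simp: emeasure_lborel_Icc_eq)
  show "AE x in lborel. norm (h x) \<le> norm ((cmod (h x))\<^sup>2 + indicator {-R..R} x)"
  proof (rule AE_I2)
    fix x
    show "norm (h x) \<le> norm ((cmod (h x))\<^sup>2 + indicator {-R..R} x)"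
    proof (cases "x \<in> {-R..R}")
      case True
      then show ?thesis
        using zero_le_power2[of "cmod (h x) - 1/2"] by (simp add: power2_eq_square algebra_simps)
    next
      case False
      then show ?thesis using supp[of x] by (cases "\<bar>x\<bar> > R") auto
    qed
  qed
qed simp

lemma integrable_times_echar:
  assumes "integrable lborel h"
  shows "integrable lborel (\<lambda>\<xi>. h \<xi> * echar (c * \<xi>))" "integrable lborel (\<lambda>\<xi>. h \<xi> * echar (- (\<xi> * c)))"
  using assms by (auto intro!: Bochner_Integration.integrable_bound[OF assms] simp: norm_mult)

lemma inv_fourier_diff_scaled:
  assumes "integrable lborel h" "integrable lborel g"
  shows "inv_fourier (\<lambda>x. h x - c * g x) = (\<lambda>x. inv_fourier h x - c * inv_fourier g x)"
  unfolding inv_fourier_def using integrable_times_echar(1)[OF assms(1)] integrable_times_echar(1)[OF assms(2)]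
  by (simp add: left_diff_distrib mult.assoc)

text \<open>Polarization: the squared norms of \<open>h - c g\<close> for \<open>c = 1\<close> and \<open>c = \<i>\<close> determine the inner product.\<close>

lemma plancherel_inner_on:
  assumes h: "h \<in> borel_measurable borel" "L2_on lborel h" "\<And>x. \<bar>x\<bar> > R \<Longrightarrow> h x = 0"
    and g: "g \<in> borel_measurable borel" "L2_on lborel g" "\<And>x. \<bar>x\<bar> > R \<Longrightarrow> g x = 0"
  shows "inner_on lborel (inv_fourier h) (inv_fourier g) = inner_on lborel h g"
proof -
  note [measurable] = h(1) g(1)
  note ih = L2_bounded_support_integrable[OF h] and ig = L2_bounded_support_integrable[OF g]
  note ph = plancherel_bounded_support[OF h] and pg = plancherel_bounded_support[OF g]
  have "Re (cnj c * inner_on lborel (inv_fourier h) (inv_fourier g)) = Re (cnj c * inner_on lborel h g)" for c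
  proof -
    have "norm_sq lborel (inv_fourier (\<lambda>x. h x - c * g x)) = norm_sq lborel (\<lambda>x. h x - c * g x)"
      by (rule plancherel_bounded_support(2)[where R=R])
         (simp_all add: h(3) g(3) L2_on_diff L2_on_mult_left h(2) g(2))
    then have "norm_sq lborel (\<lambda>x. inv_fourier h x - c * inv_fourier g x) = norm_sq lborel (\<lambda>x. h x - c * g x)"
      by (simp only: inv_fourier_diff_scaled[OF ih ig])
    then show ?thesis
      by (simp only: norm_sq_diff_scaled[OF h(2) g(2)] norm_sq_diff_scaled[OF ph(1) pg(1)] ph(2) pg(2))
  qed
  from this[of 1] this[of \<i>] show ?thesis by (simp add: complex_eq_iff)
qed

text \<open>By Fubini, the two transforms are adjoint to each other.\<close>

lemma inner_on_inv_fourier_eq_inner_on_fourier: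
  assumes f: "integrable lborel f" and h: "integrable lborel h"
  shows "inner_on lborel f (inv_fourier h) = inner_on lborel (fourier f) h"
proof -
  have [measurable]: "f \<in> borel_measurable borel" "h \<in> borel_measurable borel"
    using f h by auto
  define F where "F = (\<lambda>(x, \<xi>). f x * cnj (h \<xi>) * echar (- (x * \<xi>)))"
  have [measurable]: "F \<in> borel_measurable (lborel \<Otimes>\<^sub>M lborel)"
    unfolding F_def by measurable
  have int: "integrable (lborel \<Otimes>\<^sub>M lborel) F"
  proof (rule lborel_pair.Fubini_integrable)
    show "integrable lborel (\<lambda>x. LINT y|lborel. norm (F (x, y)))"
      unfolding F_def using f by (simp add: norm_mult integrable_mult_left)
    show "AE x in lborel. integrable lborel (\<lambda>y. F (x, y))"
    proof (rule AE_I2)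
      fix x
      have "integrable lborel (\<lambda>y. f x * (cnj (h y) * echar (- x * y)))"
        using integrable_times_echar(1)[of "\<lambda>y. cnj (h y)" "- x"] h by auto
      then show "integrable lborel (\<lambda>y. F (x, y))" by (simp add: F_def mult.assoc)
    qed
  qed measurable
  have "inner_on lborel f (inv_fourier h) = (LINT x|lborel. LINT \<xi>|lborel. F (x, \<xi>))"
  proof -
    have "f x * cnj (inv_fourier h x) = (LINT \<xi>|lborel. F (x, \<xi>))" for x
    proof -
      have "cnj (inv_fourier h x) = (LINT \<xi>|lborel. cnj (h \<xi> * echar (x * \<xi>)))"
        unfolding inv_fourier_def by (rule Bochner_Integration.integral_cnj[symmetric])
      then show ?thesis by (simp add: F_def cnj_echar mult.assoc)
    qed
    then show ?thesis by (simp add: inner_on_def)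
  qed
  also have "\<dots> = (LINT \<xi>|lborel. LINT x|lborel. F (x, \<xi>))"
    using lborel_pair.Fubini_integral[of "\<lambda>x \<xi>. F (x, \<xi>)"] int by simp
  also have "\<dots> = inner_on lborel (fourier f) h"
  proof -
    have "(LINT x|lborel. F (x, \<xi>)) = fourier f \<xi> * cnj (h \<xi>)" for \<xi>
      unfolding F_def fourier_def by (simp add: mult.assoc mult.left_commute[of _ "cnj (h \<xi>)"] mult.commute[of _ "cnj (h \<xi>)"])
    then show ?thesis by (simp add: inner_on_def)
  qed
  finally show ?thesis .
qed

section \<open>Wavelets from sets that tile by translations and by dilations\<close>

text \<open>The wavelet notions refer to the Lebesgue measure and to arbitrary Lebesgue measurable functions,
whereas the arguments above, which rest on Fubini's theorem for the product of Borel measures, concern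
Borel functions. The change of setting is harmless because a Lebesgue measurable function has a
Borel version.\<close>

lemma square_integrable_borel_iff:
  assumes "f \<in> borel_measurable borel"
  shows "square_integrable f \<longleftrightarrow> L2_on lborel f"
proof -
  have [measurable]: "f \<in> borel_measurable lborel" using assms by simp
  show ?thesis unfolding square_integrable_def L2_on_def
    by (subst integrable_completion) (auto intro: measurable_completion)
qed

lemma L2_inner_borel:
  assumes "f \<in> borel_measurable borel" "g \<in> borel_measurable borel"
  shows "L2_inner f g = inner_on lborel f g"
proof -
  have [measurable]: "f \<in> borel_measurable lborel" "g \<in> borel_measurable lborel" using assms by auto
  show ?thesis unfolding L2_inner_def inner_on_def by (subst integral_completion) auto
qed

lemma L2_dist_sq_eq_norm_sq:
  assumes "L2_on lborel (\<lambda>x. f x - g x)"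
  shows "L2_dist_sq f g = ennreal (norm_sq lborel (\<lambda>x. f x - g x))"
  unfolding L2_dist_sq_def nn_integral_completion by (rule norm_sq_nn_integral[OF assms])

lemma square_integrable_borel_version:
  assumes "square_integrable f"
  obtains g where "g \<in> borel_measurable borel" "L2_on lborel g" "AE x in lebesgue. f x = g x"
proof -
  have fm: "f \<in> borel_measurable lebesgue" using assms by (simp add: square_integrable_def)
  then have "(\<lambda>x. Re (f x)) \<in> borel_measurable lebesgue" "(\<lambda>x. Im (f x)) \<in> borel_measurable lebesgue"
    by auto
  from this[THEN completion_ex_borel_measurable_real]
  obtain u v where u: "u \<in> borel_measurable lborel" "AE x in lborel. Re (f x) = u x"
    and v: "v \<in> borel_measurable lborel" "AE x in lborel. Im (f x) = v x" by blast
  define g where "g x = Complex (u x) (v x)" for x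
  have [measurable]: "u \<in> borel_measurable borel" "v \<in> borel_measurable borel" using u v by auto
  have g_eq: "g = (\<lambda>x. of_real (u x) + \<i> * of_real (v x))"
    by (auto simp: g_def complex_eq_iff)
  have gm: "g \<in> borel_measurable borel" unfolding g_eq by measurable
  have "AE x in lborel. f x = g x"
    using u(2) v(2) by eventually_elim (simp add: g_def complex_eq_iff)
  then have ae: "AE x in lebesgue. f x = g x" by (rule AE_completion)
  have "L2_on lebesgue f" using assms by (simp add: square_integrable_def L2_on_def)
  then have "L2_on lebesgue g"
    by (rule L2_on_cong_AE) (use gm ae in \<open>auto intro: measurable_completion\<close>)
  then have "L2_on lborel g"
    using square_integrable_borel_iff[OF gm] by (simp add: square_integrable_def L2_on_def)
  with gm ae show ?thesis by (intro that)
qed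

lemma fourier_integral_borel:
  assumes [measurable]: "f \<in> borel_measurable borel" shows "fourier_integral f = fourier f"
proof
  fix \<xi>
  have e: "exp (- 2 * complex_of_real pi * \<i> * complex_of_real x * complex_of_real \<xi>) = echar (- (x * \<xi>))" for x
    by (simp add: echar_def cis_conv_exp algebra_simps)
  have "(\<lambda>x. f x * echar (- (x * \<xi>))) \<in> borel_measurable lborel" by measurable
  then show "fourier_integral f \<xi> = fourier f \<xi>"
    unfolding fourier_integral_def fourier_def e by (rule integral_completion)
qed

lemma half_power: "2 powi j * 2 powr (- of_int j / 2) = (2::real) powr (of_int j / 2)"
proof -
  have "(2::real) powi j = 2 powr (of_int j)" by (simp add: powr_real_of_int')
  then show ?thesis by (simp add: powr_add[symmetric])
qed

lemma half_power_sq: "2 powi j * (2 powr (- of_int j / 2))\<^sup>2 = (1::real)"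
proof -
  have "(2::real) powi j = 2 powr (of_int j)" by (simp add: powr_real_of_int')
  then show ?thesis by (simp add: powr_add[symmetric] power2_eq_square)
qed

lemma powi_cancel: "2 powi (- j) * (2 powi j * x) = (x::real)"
  by (simp add: power_int_minus)

lemma lborel_integral_dilate:
  fixes f :: "real \<Rightarrow> complex"
  shows "(LINT x|lborel. f x) = of_real (2 powi j) * (LINT x|lborel. f (2 powi j * x))"
  using lborel_integral_real_affine[of "2 powi j" f 0] by (simp add: scaleR_conv_of_real)

lemma nn_integral_dilate:
  fixes f :: "real \<Rightarrow> ennreal"
  assumes "f \<in> borel_measurable borel"
  shows "(\<integral>\<^sup>+x. f x \<partial>lborel) = ennreal (2 powi j) * (\<integral>\<^sup>+x. f (2 powi j * x) \<partial>lborel)"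
  using nn_integral_real_affine[OF assms, of "2 powi j" 0] by simp

text \<open>In the sequel \<open>K\<close> is a bounded set that tiles both by translations and by dilations.\<close>

locale wavelet_tile =
  fixes K :: "real set"
  assumes trans: "trans_tile K" and bdd: "bounded K"
    and dil: "AE x in lborel. \<exists>!j::int. 2 powi j * x \<in> K"
begin

lemma K_borel [measurable]: "K \<in> sets borel"
  using trans by (rule trans_tile_borel)

definition psi :: "real \<Rightarrow> complex" where "psi = inv_fourier (indicator K)"

text \<open>The Fourier transforms of the members of the wavelet system, which are exponentials on the dilates
of \<open>K\<close>.\<close>

definition wave_hat :: "int \<times> int \<Rightarrow> real \<Rightarrow> complex" where
  "wave_hat = (\<lambda>(j, k) \<xi>. of_real (2 powr (- of_int j / 2)) * echar (- (of_int k * (2 powi (- j) * \<xi>)))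
     * indicator K (2 powi (- j) * \<xi>))"

lemma wave_hat_measurable [measurable]: "wave_hat i \<in> borel_measurable borel"
  unfolding wave_hat_def by (cases i) simp

lemma inv_fourier_wave_hat: "inv_fourier (wave_hat i) = wavelet_system psi i"
proof
  fix x
  obtain j k where i: "i = (j, k)" by (cases i)
  have eq: "wave_hat i (2 powi j * \<eta>) * echar (x * (2 powi j * \<eta>)) =
      of_real (2 powr (- of_int j / 2)) * (indicator K \<eta> * echar ((2 powi j * x - of_int k) * \<eta>))" for \<eta>
  proof -
    have "echar ((2 powi j * x - of_int k) * \<eta>) = echar (- (of_int k * \<eta>)) * echar (x * (2 powi j * \<eta>))"
      by (simp add: echar_add[symmetric] algebra_simps)
    then show ?thesis by (simp add: i wave_hat_def powi_cancel)
  qed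
  have "inv_fourier (wave_hat i) x = of_real (2 powi j) *
      (LINT \<eta>|lborel. of_real (2 powr (- of_int j / 2)) * (indicator K \<eta> * echar ((2 powi j * x - of_int k) * \<eta>)))"
    unfolding inv_fourier_def by (subst lborel_integral_dilate[of _ j]) (simp only: eq)
  also have "\<dots> = of_real (2 powi j * 2 powr (- of_int j / 2)) * psi (2 powi j * x - of_int k)"
    by (simp add: psi_def inv_fourier_def)
  finally show "inv_fourier (wave_hat i) x = wavelet_system psi i x"
    unfolding half_power by (simp add: wavelet_system_def i)
qed

lemma integrable_indicator_K: "integrable lborel (indicator K :: real \<Rightarrow> real)"
proof -
  obtain R where "K \<subseteq> {-R..R}"
    using bdd by (auto simp: bounded_iff abs_le_iff) (metis abs_le_iff minus_le_iff subsetI atLeastAtMost_iff)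
  then have "emeasure lborel K \<le> emeasure lborel {-R..R}" by (intro emeasure_mono) auto
  also have "\<dots> < \<infinity>" by (simp add: emeasure_lborel_Icc_eq)
  finally show ?thesis by (intro integrable_real_indicator) auto
qed

lemma wave_hat_support:
  obtains R where "\<And>x. \<bar>x\<bar> > R \<Longrightarrow> wave_hat i x = 0"
proof -
  obtain j k where i: "i = (j, k)" by (cases i)
  obtain R where R: "\<And>x. x \<in> K \<Longrightarrow> \<bar>x\<bar> \<le> R" using bdd by (auto simp: bounded_iff)
  show ?thesis
  proof (rule that[of "2 powi j * R"])
    fix x :: real assume x: "\<bar>x\<bar> > 2 powi j * R"
    have "2 powi (- j) * x \<notin> K"
    proof
      assume "2 powi (- j) * x \<in> K"
      from R[OF this] have "2 powi (- j) * \<bar>x\<bar> \<le> R" by (simp add: abs_mult)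
      then have "\<bar>x\<bar> \<le> 2 powi j * R" by (simp add: power_int_minus field_simps)
      with x show False by simp
    qed
    then show "wave_hat i x = 0" by (simp add: wave_hat_def i)
  qed
qed

lemma wave_hat_L2: "L2_on lborel (wave_hat i)"
proof -
  obtain j k where i: "i = (j, k)" by (cases i)
  have "(cmod (wave_hat i x))\<^sup>2 = (2 powr (- of_int j / 2))\<^sup>2 * indicator K (2 powi (- j) * x)" for x
    by (auto simp: wave_hat_def i norm_mult power_mult_distrib split: split_indicator)
  then show ?thesis
    using lborel_integrable_real_affine[OF integrable_indicator_K, of "2 powi (- j)" 0]
    by (simp add: L2_on_def)
qed

text \<open>Different scales live on disjoint dilates of \<open>K\<close>; on the same scale this is the orthonormality of the
exponentials on the translation tile \<open>K\<close>.\<close>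

lemma wave_hat_orthonormal: "inner_on lborel (wave_hat i) (wave_hat i') = (if i = i' then 1 else 0)"
proof -
  obtain j k j' k' where i: "i = (j, k)" "i' = (j', k')" by (cases i, cases i')
  show ?thesis
  proof (cases "j = j'")
    case False
    have "inner_on lborel (wave_hat i) (wave_hat i') = 0"
      unfolding inner_on_def
    proof (rule integral_eq_zero_AE)
      show "AE x in lborel. wave_hat i x * cnj (wave_hat i' x) = 0"
        using dil
      proof eventually_elim
        case (elim x)
        have "\<not> (2 powi (- j) * x \<in> K \<and> 2 powi (- j') * x \<in> K)"
          using elim False by (metis neg_equal_iff_equal)
        then show ?case by (auto simp: wave_hat_def i)
      qed
    qed
    then show ?thesis using False by (simp add: i)
  next
    case True
    have "inner_on lborel (wave_hat i) (wave_hat i') = of_real (2 powi j) *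
        (LINT \<eta>|lborel. of_real ((2 powr (- of_int j / 2))\<^sup>2) *
           (indicator K \<eta> *\<^sub>R (echar (of_int (- k) * \<eta>) * cnj (echar (of_int (- k') * \<eta>)))))"
      unfolding inner_on_def i wave_hat_def True
      by (subst lborel_integral_dilate[of _ j'])
         (auto intro!: arg_cong[of _ _ "(*) _"] Bochner_Integration.integral_cong
           simp: powi_cancel power2_eq_square split: split_indicator)
    also have "\<dots> = of_real (2 powi j * (2 powr (- of_int j / 2))\<^sup>2) *
        inner_on (restrict_space lborel K) (\<lambda>\<eta>. echar (of_int (- k) * \<eta>)) (\<lambda>\<eta>. echar (of_int (- k') * \<eta>))"
    proof -
      have "(LINT \<eta>|restrict_space lborel K. g \<eta>) = (LINT \<eta>|lborel. indicator K \<eta> *\<^sub>R g \<eta>)" for g :: "real \<Rightarrow> complex"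
        by (simp add: integral_restrict_space)
      then show ?thesis by (simp only: inner_on_def integral_mult_right_zero of_real_mult mult.assoc)
    qed
    also have "\<dots> = (if k = k' then 1 else 0)"
      unfolding orthonormal_exp_tile[OF trans] half_power_sq by simp
    finally show ?thesis using True by (simp add: i)
  qed
qed

lemma wavelet_system_measurable [measurable]: "wavelet_system psi i \<in> borel_measurable borel"
  unfolding inv_fourier_wave_hat[symmetric] by measurable

lemma wavelet_system_orthonormal: "orthonormal_on lborel (wavelet_system psi)"
proof -
  have L2: "L2_on lborel (wavelet_system psi i)" for i
    using wave_hat_support[of i] plancherel_bounded_support(1)[OF wave_hat_measurable wave_hat_L2]
    by (metis inv_fourier_wave_hat)
  have "inner_on lborel (wavelet_system psi i) (wavelet_system psi i') = (if i = i' then 1 else 0)" for i i'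
  proof -
    obtain R where R: "\<And>x. \<bar>x\<bar> > R \<Longrightarrow> wave_hat i x = 0" using wave_hat_support[of i] by blast
    obtain R' where R': "\<And>x. \<bar>x\<bar> > R' \<Longrightarrow> wave_hat i' x = 0" using wave_hat_support[of i'] by blast
    have "inner_on lborel (inv_fourier (wave_hat i)) (inv_fourier (wave_hat i')) = inner_on lborel (wave_hat i) (wave_hat i')"
      by (rule plancherel_inner_on[where R = "max R R'"]) (auto simp: R R' wave_hat_L2)
    then show ?thesis by (simp add: inv_fourier_wave_hat wave_hat_orthonormal)
  qed
  with L2 show ?thesis by (simp add: orthonormal_on_def)
qed

text \<open>By adjointness the coefficients at scale \<open>j\<close> are the Fourier coefficients on \<open>K\<close> of the dilated transform
of \<open>f\<close>. Parseval on the tile shows that this scale accounts exactly for the part of the transform that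
lives on the dilate \<open>2\<^sup>j K\<close>.\<close>

lemma wavelet_parseval_scale:
  assumes f [measurable]: "f \<in> borel_measurable borel" and L: "L2_on lborel f"
    and supp: "\<And>x. \<bar>x\<bar> > R \<Longrightarrow> f x = 0"
  shows "(\<integral>\<^sup>+k. ennreal ((cmod (inner_on lborel f (wavelet_system psi (j, k))))\<^sup>2) \<partial>count_space UNIV) =
     (\<integral>\<^sup>+\<xi>. ennreal ((cmod (fourier f \<xi>))\<^sup>2) * indicator K (2 powi (- j) * \<xi>) \<partial>lborel)"
proof -
  define h where "h \<eta> = of_real (2 powr (of_int j / 2)) * fourier f (2 powi j * \<eta>)" for \<eta>
  have hm [measurable]: "h \<in> borel_measurable borel" unfolding h_def by measurable
  have ch: "(cmod (h \<eta>))\<^sup>2 = 2 powi j * (cmod (fourier f (2 powi j * \<eta>)))\<^sup>2" for \<eta>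
  proof -
    have "(2 powr (of_int j / 2))\<^sup>2 = (2::real) powr (of_int j)"
      by (simp add: power2_eq_square powr_add[symmetric])
    then show ?thesis by (simp add: h_def norm_mult power_mult_distrib powr_real_of_int')
  qed
  note fourier_L2 = fourier_plancherel(1)[OF f L supp]
  have int: "integrable lborel (\<lambda>\<eta>. (cmod (h \<eta>))\<^sup>2)"
    unfolding ch using lborel_integrable_real_affine[of "\<lambda>\<xi>. (cmod (fourier f \<xi>))\<^sup>2" "2 powi j" 0] fourier_L2
    by (auto simp: L2_on_def)
  have hL: "L2_on (restrict_space lborel K) h"
    unfolding L2_on_def
    using integrable_mult_indicator[of K lborel, OF _ int]
    by (auto simp: integrable_restrict_space measurable_restrict_space1)
  have coeff: "inner_on lborel f (wavelet_system psi (j, k)) = inner_on (restrict_space lborel K) h (\<lambda>\<eta>. echar (of_int (- k) * \<eta>))" for k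
  proof -
    obtain R' where R': "\<And>x. \<bar>x\<bar> > R' \<Longrightarrow> wave_hat (j, k) x = 0" using wave_hat_support[of "(j, k)"] by blast
    have "inner_on lborel f (wavelet_system psi (j, k)) = inner_on lborel (fourier f) (wave_hat (j, k))"
      unfolding inv_fourier_wave_hat[symmetric]
      by (intro inner_on_inv_fourier_eq_inner_on_fourier L2_bounded_support_integrable[OF f L supp]
          L2_bounded_support_integrable[OF wave_hat_measurable wave_hat_L2 R'])
    also have "\<dots> = of_real (2 powi j) * (LINT \<eta>|lborel. of_real (2 powr (- of_int j / 2)) *
        (indicator K \<eta> *\<^sub>R (fourier f (2 powi j * \<eta>) * cnj (echar (of_int (- k) * \<eta>)))))"
      unfolding inner_on_def wave_hat_def
      by (subst lborel_integral_dilate[of _ j])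
         (auto intro!: arg_cong[of _ _ "(*) _"] Bochner_Integration.integral_cong
           simp: powi_cancel split: split_indicator)
    also have "\<dots> = of_real (2 powi j * 2 powr (- of_int j / 2)) *
        (LINT \<eta>|restrict_space lborel K. fourier f (2 powi j * \<eta>) * cnj (echar (of_int (- k) * \<eta>)))"
    proof -
      have "(LINT \<eta>|restrict_space lborel K. g \<eta>) = (LINT \<eta>|lborel. indicator K \<eta> *\<^sub>R g \<eta>)" for g :: "real \<Rightarrow> complex"
        by (simp add: integral_restrict_space)
      then show ?thesis by (simp only: integral_mult_right_zero of_real_mult mult.assoc)
    qed
    also have "\<dots> = inner_on (restrict_space lborel K) h (\<lambda>\<eta>. echar (of_int (- k) * \<eta>))"
      unfolding half_power inner_on_def h_def by (simp add: mult.assoc)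
    finally show ?thesis .
  qed
  have "(\<integral>\<^sup>+k. ennreal ((cmod (inner_on lborel f (wavelet_system psi (j, k))))\<^sup>2) \<partial>count_space UNIV) =
      ennreal (norm_sq (restrict_space lborel K) h)"
    unfolding coeff
    using nn_integral_int_uminus[of "\<lambda>k. ennreal ((cmod (inner_on (restrict_space lborel K) h (\<lambda>\<eta>. echar (of_int k * \<eta>))))\<^sup>2)"]
      parseval_tile[OF trans bdd hm hL] by simp
  also have "\<dots> = (\<integral>\<^sup>+\<eta>. ennreal ((cmod (h \<eta>))\<^sup>2) * indicator K \<eta> \<partial>lborel)"
    unfolding norm_sq_nn_integral[OF hL, symmetric] by (simp add: nn_integral_restrict_space)
  also have "\<dots> = (\<integral>\<^sup>+\<eta>. ennreal (2 powi j) * (ennreal ((cmod (fourier f (2 powi j * \<eta>)))\<^sup>2) * indicator K \<eta>) \<partial>lborel)"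
    by (simp add: ch ennreal_mult mult.assoc)
  also have "\<dots> = ennreal (2 powi j) * (\<integral>\<^sup>+\<eta>. ennreal ((cmod (fourier f (2 powi j * \<eta>)))\<^sup>2) * indicator K \<eta> \<partial>lborel)"
    by (rule nn_integral_cmult) measurable
  also have "\<dots> = (\<integral>\<^sup>+\<xi>. ennreal ((cmod (fourier f \<xi>))\<^sup>2) * indicator K (2 powi (- j) * \<xi>) \<partial>lborel)"
    by (subst (2) nn_integral_dilate[of _ j]) (simp_all add: powi_cancel)
  finally show ?thesis .
qed

text \<open>The dilates of \<open>K\<close> partition the line, so the contributions of all scales add up to the full norm of the
transform, which is that of \<open>f\<close>.\<close>

lemma wavelet_parseval:
  assumes f [measurable]: "f \<in> borel_measurable borel" and L: "L2_on lborel f"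
    and supp: "\<And>x. \<bar>x\<bar> > R \<Longrightarrow> f x = 0"
  shows "(\<integral>\<^sup>+i. ennreal ((cmod (inner_on lborel f (wavelet_system psi i)))\<^sup>2) \<partial>count_space UNIV) = ennreal (norm_sq lborel f)"
proof -
  let ?s = "\<lambda>i. ennreal ((cmod (inner_on lborel f (wavelet_system psi i)))\<^sup>2)"
  have "(\<integral>\<^sup>+i. ?s i \<partial>count_space UNIV) = (\<integral>\<^sup>+j. \<integral>\<^sup>+k. ?s (j, k) \<partial>count_space UNIV \<partial>count_space UNIV)"
    by (rule nn_integral_fst_count_space[symmetric])
  also have "\<dots> = (\<integral>\<^sup>+j. (\<integral>\<^sup>+\<xi>. ennreal ((cmod (fourier f \<xi>))\<^sup>2) * indicator K (2 powi (- j) * \<xi>) \<partial>lborel) \<partial>count_space UNIV)"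
    by (simp only: wavelet_parseval_scale[OF f L supp])
  also have "\<dots> = (\<integral>\<^sup>+j. (\<integral>\<^sup>+\<xi>. ennreal ((cmod (fourier f \<xi>))\<^sup>2) * indicator K (2 powi j * \<xi>) \<partial>lborel) \<partial>count_space UNIV)"
    by (rule nn_integral_int_uminus)
  also have "\<dots> = (\<integral>\<^sup>+\<xi>. (\<integral>\<^sup>+j. ennreal ((cmod (fourier f \<xi>))\<^sup>2) * indicator K (2 powi j * \<xi>) \<partial>count_space (UNIV :: int set)) \<partial>lborel)"
    by (rule nn_integral_count_space_nn_integral[symmetric]) auto
  also have "\<dots> = (\<integral>\<^sup>+\<xi>. ennreal ((cmod (fourier f \<xi>))\<^sup>2) \<partial>lborel)"
    using dil by (intro nn_integral_cong_AE) (auto simp: nn_integral_cmult count_space_indicator_ex1)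
  also have "\<dots> = ennreal (norm_sq lborel f)"
    using norm_sq_nn_integral[OF fourier_plancherel(1)[OF assms]] fourier_plancherel(2)[OF assms] by simp
  finally show ?thesis .
qed

lemma indicator_K_in_L2:
  shows "(indicator K :: real \<Rightarrow> complex) \<in> borel_measurable borel" "L2_on lborel (indicator K)"
    "integrable lborel (indicator K :: real \<Rightarrow> complex)"
    "\<exists>R. \<forall>x. \<bar>x\<bar> > R \<longrightarrow> indicator K x = (0 :: complex)"
proof -
  show m: "(indicator K :: real \<Rightarrow> complex) \<in> borel_measurable borel" by measurable
  have n: "norm (indicator K x :: complex) = indicator K x" for x by (auto split: split_indicator)
  have n2: "(norm (indicator K x :: complex))\<^sup>2 = indicator K x" for x by (auto split: split_indicator)
  show "L2_on lborel (indicator K)" using integrable_indicator_K by (simp add: L2_on_def n2)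
  show "integrable lborel (indicator K :: real \<Rightarrow> complex)"
    by (rule Bochner_Integration.integrable_bound[OF integrable_indicator_K]) (auto simp: n)
  obtain R where "\<And>x. x \<in> K \<Longrightarrow> \<bar>x\<bar> \<le> R" using bdd by (auto simp: bounded_iff)
  then show "\<exists>R. \<forall>x. \<bar>x\<bar> > R \<longrightarrow> indicator K x = (0 :: complex)"
    by (intro exI[of _ R]) (auto split: split_indicator; fastforce)
qed

lemma psi_in_L2:
  shows psi_measurable [measurable]: "psi \<in> borel_measurable borel"
    and psi_L2: "L2_on lborel psi" and psi_norm_sq: "norm_sq lborel psi = norm_sq lborel (indicator K)"
proof -
  note ind = indicator_K_in_L2
  obtain R where R: "\<And>x. \<bar>x\<bar> > R \<Longrightarrow> indicator K x = (0::complex)" using ind(4) by blast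
  show "psi \<in> borel_measurable borel" unfolding psi_def by (rule borel_measurable_inv_fourier[OF ind(1)])
  show "L2_on lborel psi" "norm_sq lborel psi = norm_sq lborel (indicator K)"
    unfolding psi_def using plancherel_bounded_support[OF ind(1,2) R] by auto
qed

text \<open>Truncations \<open>u\<^sub>m\<close> of \<open>\<psi>\<close> serve as approximating sequence. By Plancherel and adjointness,
\<open>\<parallel>fourier u\<^sub>m - indicator K\<parallel>\<^sup>2 = \<parallel>u\<^sub>m\<parallel>\<^sup>2 - 2 \<parallel>u\<^sub>m\<parallel>\<^sup>2 + \<parallel>\<psi>\<parallel>\<^sup>2\<close>, which is also the squared distance of
\<open>u\<^sub>m\<close> from \<open>\<psi>\<close> and tends to 0.\<close>

lemma psi_fourier: "has_L2_fourier_transform psi (indicator K)"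
proof -
  define u where "u m = truncation m psi" for m
  note T = L2_truncation[OF psi_measurable psi_L2, folded u_def]
  note ind = indicator_K_in_L2
  have iu: "integrable lborel (u m)" for m
    using L2_bounded_support_integrable[OF T(1,2), of m m] T(3)[of m] by blast
  have iu': "integrable lebesgue (u m)" for m
    using iu[of m] T(1)[of m] by (subst integrable_completion) auto
  have L: "L2_on lborel (fourier (u m))" "norm_sq lborel (fourier (u m)) = norm_sq lborel (u m)" for m
    using fourier_plancherel[OF T(1,2), of m m] T(3)[of m] by auto
  have inner_on: "inner_on lborel (fourier (u m)) (indicator K) = of_real (norm_sq lborel (u m))" for m
  proof -
    have "inner_on lborel (fourier (u m)) (indicator K) = inner_on lborel (u m) psi"
      unfolding psi_def by (rule inner_on_inv_fourier_eq_inner_on_fourier[OF iu ind(3), symmetric])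
    also have "\<dots> = inner_on lborel (u m) (u m)"
      unfolding inner_on_def u_def truncation_def by (intro Bochner_Integration.integral_cong) (auto split: split_indicator)
    finally show ?thesis by (simp add: inner_on_self)
  qed
  have n1: "norm_sq lborel (\<lambda>\<xi>. fourier (u m) \<xi> - indicator K \<xi>) = norm_sq lborel psi - norm_sq lborel (u m)" for m
    using norm_sq_diff_scaled[OF L(1)[of m] ind(2), of 1] by (simp add: inner_on L(2) psi_norm_sq)
  have "(\<lambda>m. ennreal (norm_sq lborel psi - norm_sq lborel (u m))) \<longlonglongrightarrow> ennreal (norm_sq lborel psi - norm_sq lborel psi)"
    by (intro tendsto_intros T(5))
  then have lim: "(\<lambda>m. ennreal (norm_sq lborel psi - norm_sq lborel (u m))) \<longlonglongrightarrow> 0" by simp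
  have d1: "L2_dist_sq (u m) psi = ennreal (norm_sq lborel psi - norm_sq lborel (u m))" for m
    using L2_dist_sq_eq_norm_sq[OF L2_on_diff[OF T(2) psi_L2]] T(4) by simp
  have d2: "L2_dist_sq (fourier_integral (u m)) (indicator K) = ennreal (norm_sq lborel psi - norm_sq lborel (u m))" for m
    using L2_dist_sq_eq_norm_sq[OF L2_on_diff[OF L(1) ind(2)]] n1 by (simp add: fourier_integral_borel[OF T(1)])
  show ?thesis
    unfolding has_L2_fourier_transform_def
    using square_integrable_borel_iff[OF psi_measurable] psi_L2 square_integrable_borel_iff[OF ind(1)] ind(2)
      iu' square_integrable_borel_iff[OF T(1)] T(2) lim
    by (intro conjI exI[of _ u] allI) (simp_all add: d1 d2)
qed

text \<open>Parseval's identity is available for functions of bounded support, which are dense.\<close>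

lemma wavelet_basis: "L2_orthonormal_basis (wavelet_system psi)"
proof -
  let ?e = "wavelet_system psi"
  note on = wavelet_system_orthonormal
  have L2e: "L2_on lborel (?e i)" for i using on unfolding orthonormal_on_def by blast
  have "\<exists>F c. finite F \<and> L2_dist_sq f (\<lambda>x. \<Sum>i\<in>F. c i * ?e i x) < ennreal \<delta>"
    if f: "square_integrable f" and "\<delta> > 0" for f and \<delta> :: real
  proof -
    obtain g where g: "g \<in> borel_measurable borel" "L2_on lborel g" "AE x in lebesgue. f x = g x"
      using square_integrable_borel_version[OF f] .
    define u where "u m = truncation m g" for m
    note T = L2_truncation[OF g(1,2), folded u_def]
    have "eventually (\<lambda>m. norm_sq lborel g - \<delta> / 4 < norm_sq lborel (u m)) sequentially"
      using T(5) \<open>\<delta> > 0\<close> by (intro order_tendstoD(1)) auto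
    then obtain m where m: "norm_sq lborel g - \<delta> / 4 < norm_sq lborel (u m)"
      by (auto simp: eventually_sequentially)
    have P: "(\<integral>\<^sup>+i. ennreal ((cmod (inner_on lborel (u m) (?e i)))\<^sup>2) \<partial>count_space UNIV) = ennreal (norm_sq lborel (u m))"
      using wavelet_parseval[OF T(1,2), of m m] T(3)[of m] by blast
    have "\<delta> / 4 > 0" using \<open>\<delta> > 0\<close> by simp
    from dense_of_parseval[OF on T(2) P this]
    obtain F c where F: "finite F" "norm_sq lborel (\<lambda>x. u m x - (\<Sum>i\<in>F. c i * ?e i x)) < \<delta> / 4" .
    let ?s = "\<lambda>x. \<Sum>i\<in>F. c i * ?e i x"
    have Ls: "L2_on lborel ?s" by (intro L2_on_sum L2e)
    have Lgu: "L2_on lborel (\<lambda>x. g x - u m x)" by (intro L2_on_diff g T)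
    have "norm_sq lborel (\<lambda>x. g x - u m x) = norm_sq lborel (\<lambda>x. u m x - g x)"
      by (simp add: norm_sq_def norm_minus_commute)
    then have "norm_sq lborel (\<lambda>x. (g x - u m x) + (u m x - ?s x)) < \<delta>"
      using norm_sq_add_le[OF Lgu L2_on_diff[OF T(2) Ls], of m] F(2) m T(4)[of m] by linarith
    then have "norm_sq lborel (\<lambda>x. g x - ?s x) < \<delta>" by simp
    then have "L2_dist_sq g ?s < ennreal \<delta>"
      using L2_dist_sq_eq_norm_sq[OF L2_on_diff[OF g(2) Ls]] by (simp add: ennreal_less_iff norm_sq_nonneg)
    also have "L2_dist_sq g ?s = L2_dist_sq f ?s"
      unfolding L2_dist_sq_def using g(3) by (intro nn_integral_cong_AE) auto
    finally show ?thesis using F(1) by blast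
  qed
  moreover have "square_integrable (?e i)" for i
    using L2e square_integrable_borel_iff[OF wavelet_system_measurable] by blast
  moreover have "L2_inner (?e i) (?e i') = (if i = i' then 1 else 0)" for i i'
    using on L2_inner_borel[OF wavelet_system_measurable wavelet_system_measurable]
    unfolding orthonormal_on_def by metis
  ultimately show ?thesis unfolding L2_orthonormal_basis_def by blast
qed

theorem wavelet_set_tile: "wavelet_set K"
  unfolding wavelet_set_def orthonormal_wavelet_def
  using wavelet_basis psi_fourier psi_L2 square_integrable_borel_iff[OF psi_measurable]
  by (intro conjI exI[of _ psi] exI[of _ "indicator K"]) (auto simp: indicator_def)

end

section \<open>Sums over orbits\<close>

text \<open>For an indicator this counts how often the orbit of \<open>x\<close> meets the set. A set meets
almost every orbit exactly once iff its orbit sum is 1 almost everywhere.\<close>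

definition orbit_sum :: "(int \<Rightarrow> real \<Rightarrow> real) \<Rightarrow> (real \<Rightarrow> ennreal) \<Rightarrow> real \<Rightarrow> ennreal" where
  "orbit_sum \<phi> F x = (\<integral>\<^sup>+k. F (\<phi> k x) \<partial>count_space UNIV)"

definition int_action :: "(int \<Rightarrow> real \<Rightarrow> real) \<Rightarrow> bool" where
  "int_action \<phi> \<longleftrightarrow> (\<forall>k m x. \<phi> k (\<phi> m x) = \<phi> (k + m) x) \<and> (\<forall>x. \<phi> 0 x = x)"

lemma orbit_sum_add: "orbit_sum \<phi> (\<lambda>y. F y + G y) x = orbit_sum \<phi> F x + orbit_sum \<phi> G x"
  unfolding orbit_sum_def by (rule nn_integral_add) auto

lemma orbit_sum_suminf: "orbit_sum \<phi> (\<lambda>y. \<Sum>l. F l y) x = (\<Sum>l. orbit_sum \<phi> (F l) x)"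
  unfolding orbit_sum_def by (rule nn_integral_suminf) auto

lemma orbit_sum_invariant:
  assumes "int_action \<phi>"
  shows "orbit_sum \<phi> (\<lambda>y. F (\<phi> m y)) x = orbit_sum \<phi> F x"
proof -
  have "orbit_sum \<phi> (\<lambda>y. F (\<phi> m y)) x = (\<integral>\<^sup>+k. F (\<phi> (m + k) x) \<partial>count_space UNIV)"
    using assms by (simp add: orbit_sum_def int_action_def)
  also have "\<dots> = orbit_sum \<phi> F x"
    unfolding orbit_sum_def by (rule nn_integral_bij_count_space) (auto intro!: bij_betwI[where g="\<lambda>k. k - m"])
  finally show ?thesis .
qed

lemma orbit_sum_indicator_cong:
  assumes "int_action \<phi>" "\<And>y. \<phi> m y \<in> A \<longleftrightarrow> y \<in> B"
  shows "orbit_sum \<phi> (indicator A) x = orbit_sum \<phi> (indicator B) x"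
proof -
  have "(\<lambda>y. indicator A (\<phi> m y)) = (indicator B :: real \<Rightarrow> ennreal)"
    using assms(2) by (auto simp: indicator_def)
  then show ?thesis using orbit_sum_invariant[OF assms(1), of "indicator A" m x] by simp
qed

text \<open>Countably many exceptional points only affect countably many orbits, each of them countable. This
allows closed intervals with common end points to be glued.\<close>

lemma orbit_sum_cong_AE:
  assumes act: "int_action \<phi>" and "countable E" and eq: "\<And>y. y \<notin> E \<Longrightarrow> F y = G y"
  shows "AE x in lborel. orbit_sum \<phi> F x = orbit_sum \<phi> G x"
proof -
  have inj: "inj (\<phi> k)" for k
    using act unfolding int_action_def by (intro inj_on_inverseI[of _ "\<phi> (- k)"]) auto
  have "countable (\<Union>k. \<phi> k -` E)"
    using countable_image_inj[OF \<open>countable E\<close> inj] by (auto intro!: countable_UN simp: vimage_def)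
  then have "AE x in lborel. x \<notin> (\<Union>k. \<phi> k -` E)"
    by (intro AE_not_in countable_imp_null_set_lborel)
  then show ?thesis
  proof eventually_elim
    case (elim x)
    then show ?case unfolding orbit_sum_def by (intro nn_integral_cong eq) auto
  qed
qed

lemma orbit_sum_indicator_ex1:
  assumes "orbit_sum \<phi> (indicator A) x = 1" shows "\<exists>!k. \<phi> k x \<in> A"
proof -
  have "(\<lambda>k. indicator A (\<phi> k x)) = (indicator {k. \<phi> k x \<in> A} :: int \<Rightarrow> ennreal)"
    by (auto simp: indicator_def)
  then have "emeasure (count_space UNIV) {k. \<phi> k x \<in> A} = 1"
    using assms by (simp add: orbit_sum_def)
  then have "card {k. \<phi> k x \<in> A} = 1"
    by (auto simp: emeasure_count_space split: if_splits)
  then obtain i where "{k. \<phi> k x \<in> A} = {i}" by (auto simp: card_1_singleton_iff)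
  then have "\<phi> k x \<in> A \<longleftrightarrow> k = i" for k by blast
  then show ?thesis by simp
qed

lemma int_action_translate: "int_action (\<lambda>k x. x + of_int k)"
  by (simp add: int_action_def)

lemma int_action_dilate: "int_action (\<lambda>j x. 2 powi j * x)"
  by (simp add: int_action_def power_int_add)

lemma orbit_sum_half_open: "orbit_sum (\<lambda>k x. x + of_int k) (indicator {a..<a + 1}) x = 1"
  unfolding orbit_sum_def by (rule count_space_indicator_ex1) (rule ex1_translate_half_open)

lemma ex1_dilate_annulus:
  assumes "a > 0" "x \<noteq> (0::real)"
  shows "\<exists>!j::int. 2 powi j * x \<in> {y. a \<le> \<bar>y\<bar> \<and> \<bar>y\<bar> < 2 * a}"
proof -
  define t where "t = log 2 (a / \<bar>x\<bar>)"
  have t: "2 powr t = a / \<bar>x\<bar>" using assms by (simp add: t_def)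
  have iff: "2 powi j * x \<in> {y. a \<le> \<bar>y\<bar> \<and> \<bar>y\<bar> < 2 * a} \<longleftrightarrow> j = \<lceil>t\<rceil>" for j :: int
  proof -
    have "(2::real) powi j = 2 powr (of_int j)" by (simp add: powr_real_of_int')
    then have y: "\<bar>2 powi j * x\<bar> = 2 powr (of_int j) * \<bar>x\<bar>" by (simp add: abs_mult)
    have "a \<le> 2 powr (of_int j) * \<bar>x\<bar> \<longleftrightarrow> 2 powr t \<le> 2 powr (of_int j)"
      using assms by (simp add: t divide_le_eq)
    also have "\<dots> \<longleftrightarrow> t \<le> of_int j" by simp
    finally have 1: "a \<le> 2 powr (of_int j) * \<bar>x\<bar> \<longleftrightarrow> t \<le> of_int j" .
    have "2 powr (of_int j) * \<bar>x\<bar> < 2 * a \<longleftrightarrow> 2 powr (of_int j) < 2 powr (t + 1)"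
      using assms by (simp add: powr_add t less_divide_eq mult.commute)
    also have "\<dots> \<longleftrightarrow> of_int j < t + 1" by simp
    finally have 2: "2 powr (of_int j) * \<bar>x\<bar> < 2 * a \<longleftrightarrow> of_int j < t + 1" .
    have "j = \<lceil>t\<rceil> \<longleftrightarrow> t \<le> of_int j \<and> of_int j < t + 1"
      using ceiling_eq_iff[of t j] by auto
    then show ?thesis using 1 2 y by simp
  qed
  then show ?thesis by simp
qed

lemma indicator_Icc_glue:
  fixes u v w y :: real
  assumes "u \<le> v" "v \<le> w" "y \<noteq> v"
  shows "indicator {u..v} y + indicator {v..w} y = (indicator {u..w} y :: ennreal)"
  using assms by (cases "y < v") (auto simp: indicator_def)

section \<open>The tilings of the sets W\<close>

locale W_parameters =
  fixes n :: nat and \<epsilon> :: real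
  assumes n: "n \<ge> 2" and eps: "0 < \<epsilon>" "\<epsilon> < a_end n / 2"
begin

abbreviation "a \<equiv> a_end n"
abbreviation "b \<equiv> b_end n"
abbreviation "c \<equiv> c_end n"
abbreviation "d \<equiv> d_end n"
abbreviation "e \<equiv> e_end n"
text \<open>The length of the translations that define the \<open>X\<^sub>l\<close>. In terms of \<open>N\<close> the powers of 2 in the end points
become \<open>2N\<close>, \<open>4N\<close> and \<open>4N\<^sup>2\<close>, so that only linear relations between \<open>a\<close> and \<open>N a\<close> remain.\<close>

definition N :: real where "N = 2 ^ (n - 2)"
definition X :: "real set" where "X = (\<Union>l. X_set n \<epsilon> l)"
definition Y :: "real set" where "Y = (\<Union>l. Y_set n \<epsilon> l)"

lemma N_ge_1: "N \<ge> 1"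
  by (simp add: N_def)

lemma two_powers: "2 ^ n = 4 * N" "2 ^ (n - 1) = 2 * N" "2 ^ (2 * n - 2) = 4 * N * N"
proof -
  define m where "m = n - 2"
  have nm: "n = Suc (Suc m)" using n by (simp add: m_def)
  have N: "N = 2 ^ m" by (simp add: N_def m_def)
  have e: "n - 1 = Suc m" "2 * n - 2 = Suc (Suc (m + m))" by (simp_all add: nm)
  show "2 ^ n = 4 * N" unfolding N by (subst nm) simp
  show "2 ^ (n - 1) = 2 * N" unfolding N e by simp
  show "2 ^ (2 * n - 2) = 4 * N * N" unfolding N e by (simp add: power_add)
qed

lemma ends: "4 * N * a = N + a" "b = 2 * a" "d = N + a" "e = 1 - 2 * a" "c = N - a" "c = 2 * N * e"
proof -
  define q where "q = 4 * N - 1"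
  have q: "q > 0" using N_ge_1 by (simp add: q_def)
  have a: "a = N / q"
    unfolding a_end_def two_powers(1) q_def by (simp add: N_def)
  then have aq: "a * q = N" using q by simp
  then show 1: "4 * N * a = N + a" unfolding q_def by (simp add: algebra_simps)
  show b: "b = 2 * a" unfolding b_end_def two_powers a q_def by simp
  have d: "d = 4 * N * a" unfolding d_end_def two_powers a q_def by simp
  show "d = N + a" unfolding d by (rule 1)
  have e: "e = (2 * N - 1) / q" unfolding e_end_def two_powers q_def ..
  have "(1 - 2 * a) * q = q - 2 * (a * q)" by (simp add: algebra_simps)
  also have "\<dots> = 2 * N - 1" unfolding aq by (simp add: q_def)
  finally show e2: "e = 1 - 2 * a" unfolding e using q by (simp add: divide_eq_eq)
  show c: "c = 2 * N * e" unfolding c_end_def e two_powers q_def by simp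
  have "2 * N * e = 2 * N - 4 * N * a" unfolding e2 by (simp add: algebra_simps)
  then show "c = N - a" unfolding c 1 by simp
qed

lemma a_bounds: "0 < a" "a * (2 * N + 1) \<le> N" "3 * a \<le> 1"
proof -
  have aN: "a * (4 * N - 1) = N" using ends(1) by (simp add: algebra_simps)
  show a: "0 < a"
  proof (rule ccontr)
    assume "\<not> 0 < a"
    then have "a * (4 * N - 1) \<le> 0" using N_ge_1 by (intro mult_nonpos_nonneg) auto
    then show False using aN N_ge_1 by simp
  qed
  have "a * (2 * N + 1) \<le> a * (4 * N - 1)" using a N_ge_1 by (intro mult_left_mono) auto
  then show "a * (2 * N + 1) \<le> N" unfolding aN .
  have "a * (3 * N) \<le> a * (4 * N - 1)" using a N_ge_1 by (intro mult_left_mono) auto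
  then have "(3 * a) * N \<le> 1 * N" unfolding aN by simp
  then show "3 * a \<le> 1" using mult_right_le_imp_le[of "3 * a" N 1] N_ge_1 by simp
qed

lemma eps_N: "\<epsilon> / 2 ^ n > 0" "\<epsilon> / 2 ^ n = \<epsilon> / (4 * N)" "\<epsilon> / (4 * N) < \<epsilon>"
  using eps(1) N_ge_1 by (simp_all add: two_powers field_simps)

lemma P1_subset: "P1 n \<epsilon> \<subseteq> {0<..<a}"
proof
  fix x assume "x \<in> P1 n \<epsilon>"
  then have "a / 2 + \<epsilon> / 2 ^ n \<le> x" "x \<le> a / 2 + \<epsilon>" by (auto simp: P1_def)
  then have "0 < x" "x < a" using eps eps_N(1) a_bounds(1) by linarith+
  then show "x \<in> {0<..<a}" by simp
qed

lemma X_set_Suc: "X_set n \<epsilon> (Suc l) = (\<lambda>x. x - N) ` Y_set n \<epsilon> l"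
  by (simp add: N_def)

lemma X_set_0: "X_set n \<epsilon> 0 = (\<lambda>x. x - N) ` P1 n \<epsilon>"
  by (simp add: N_def)

declare X_set.simps [simp del]

text \<open>The lower bound comes from \<open>N + a = 4 N a\<close>. The upper bound amounts to \<open>a (2 N + 1) \<le> N\<close>, that is
\<open>N \<ge> 1\<close>, and keeps consecutive \<open>Y\<^sub>l\<close> apart.\<close>

lemma Y_of_X_location:
  assumes "X_set n \<epsilon> l \<subseteq> {- N - a<..<- N + a}"
  shows "Y_set n \<epsilon> l \<subseteq> {- a / 2 ^ l<..<- a / 2 ^ Suc l}"
proof
  fix y assume "y \<in> Y_set n \<epsilon> l"
  then obtain x where "x \<in> X_set n \<epsilon> l" and y0: "y = 1 / 2 ^ (n + l) * x"
    by (auto simp: Y_set.simps)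
  with assms have x: "- N - a < x" "x < - N + a" by auto
  have y: "y = (x / (4 * N)) / 2 ^ l" using y0 by (simp add: power_add two_powers)
  have N0: "4 * N > 0" using N_ge_1 by simp
  have "- a * (4 * N) < x" using x(1) ends(1) by (simp add: mult.commute)
  then have 1: "- a < x / (4 * N)" using N0 by (simp only: pos_less_divide_eq)
  have "x < - (a / 2) * (4 * N)" using x(2) a_bounds(2) by (simp add: algebra_simps)
  then have 2: "x / (4 * N) < - (a / 2)" using N0 by (simp only: pos_divide_less_eq)
  have "- a / 2 ^ l < y" unfolding y by (rule divide_strict_right_mono[OF 1]) simp
  moreover have "y < - (a / 2) / 2 ^ l" unfolding y by (rule divide_strict_right_mono[OF 2]) simp
  ultimately show "y \<in> {- a / 2 ^ l<..<- a / 2 ^ Suc l}" by simp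
qed

lemma a_scale_bounds: "a / 2 ^ l \<le> a" "a / 2 ^ l > 0"
proof -
  have "a / 2 ^ l \<le> a / 1" using a_bounds(1) by (intro divide_left_mono) auto
  then show "a / 2 ^ l \<le> a" by simp
  show "a / 2 ^ l > 0" using a_bounds(1) by simp
qed

text \<open>The interval is the interior of \<open>L\<close>, so the recursion never leaves \<open>L\<close>: the scaling by \<open>2\<^bsup>n+l\<^esup>\<close> brings it
into \<open>(-a, 0)\<close>, and translation by \<open>- N\<close> back into the left half of \<open>L\<close>.\<close>

lemma X_set_location: "X_set n \<epsilon> l \<subseteq> {- N - a<..<- N + a}"
proof (induction l)
  case 0
  show ?case
  proof
    fix x assume "x \<in> X_set n \<epsilon> 0"
    then obtain y where "y \<in> P1 n \<epsilon>" "x = y - N" by (auto simp: X_set_0)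
    then show "x \<in> {- N - a<..<- N + a}" using P1_subset a_bounds(1) by auto
  qed
next
  case (Suc l)
  show ?case
  proof
    fix x assume "x \<in> X_set n \<epsilon> (Suc l)"
    then obtain y where y: "y \<in> Y_set n \<epsilon> l" "x = y - N" by (auto simp: X_set_Suc)
    then have "- a / 2 ^ l < y" "y < - a / 2 ^ Suc l" using Y_of_X_location[OF Suc] by auto
    then show "x \<in> {- N - a<..<- N + a}"
      using y(2) a_scale_bounds[of l] a_scale_bounds[of "Suc l"] by auto
  qed
qed

lemma Y_set_location:
  assumes "y \<in> Y_set n \<epsilon> l" shows "- a / 2 ^ l < y" "y < - a / 2 ^ Suc l"
  using subsetD[OF Y_of_X_location[OF X_set_location] assms] by auto

lemma Y_subset: "Y \<subseteq> {- a<..<0}"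
proof
  fix y assume "y \<in> Y"
  then obtain l where "y \<in> Y_set n \<epsilon> l" by (auto simp: Y_def)
  then have "- a / 2 ^ l < y" "y < - a / 2 ^ Suc l" by (rule Y_set_location)+
  then show "y \<in> {- a<..<0}" using a_scale_bounds[of l] a_scale_bounds[of "Suc l"] by auto
qed

lemma disjoint_P1_Y: "P1 n \<epsilon> \<inter> Y = {}"
proof (rule equals0I)
  fix x assume "x \<in> P1 n \<epsilon> \<inter> Y"
  then have "x \<in> {0<..<a}" "x \<in> {- a<..<0}" using P1_subset Y_subset by blast+
  then show False by simp
qed

lemma X_subset: "X \<subseteq> L_int n"
proof
  fix x assume "x \<in> X"
  then obtain l where "x \<in> X_set n \<epsilon> l" by (auto simp: X_def)
  then have "x \<in> {- N - a<..<- N + a}" using X_set_location by blast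
  then show "x \<in> L_int n" by (simp add: L_int_def ends(3,5))
qed

text \<open>The recursion translates \<open>P\<^sub>1\<close> to \<open>X\<^sub>0\<close> and \<open>Y\<^sub>l\<close> to \<open>X\<^bsub>l+1\<^esub>\<close>, hence all of \<open>P\<^sub>1 \<union> Y\<close> to all of \<open>X\<close>.\<close>

lemma X_eq_translate: "x - N \<in> X \<longleftrightarrow> x \<in> P1 n \<epsilon> \<union> Y"
proof -
  have "x - N \<in> X \<longleftrightarrow> x - N \<in> X_set n \<epsilon> 0 \<or> (\<exists>l. x - N \<in> X_set n \<epsilon> (Suc l))"
    unfolding X_def by (metis UN_iff UNIV_I not0_implies_Suc)
  also have "\<dots> \<longleftrightarrow> x \<in> P1 n \<epsilon> \<union> Y"
    by (auto simp: X_set_0 X_set_Suc Y_def)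
  finally show ?thesis .
qed

lemma disjoint_Y: "disjoint_family (Y_set n \<epsilon>)"
proof -
  have "Y_set n \<epsilon> l \<inter> Y_set n \<epsilon> m = {}" if "l < m" for l m
  proof -
    have "a / 2 ^ m \<le> a / 2 ^ Suc l"
      using that a_bounds(1) by (intro divide_left_mono power_increasing) auto
    then show ?thesis
      using Y_set_location(2)[of _ l] Y_set_location(1)[of _ m] by fastforce
  qed
  then show ?thesis unfolding disjoint_family_on_def by (metis Int_commute linorder_neqE_nat)
qed

text \<open>The scaling factors of the \<open>Y\<^sub>l\<close> vary with \<open>l\<close>, so disjointness of the \<open>X\<^sub>l\<close> is inherited through the
translation, from the disjoint sets \<open>P\<^sub>1\<close> and \<open>Y\<^sub>l\<close>.\<close>

lemma disjoint_X: "disjoint_family (X_set n \<epsilon>)"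
proof -
  have "X_set n \<epsilon> l \<inter> X_set n \<epsilon> m = {}" if "l < m" for l m
  proof -
    obtain m' where m: "m = Suc m'" using \<open>l < m\<close> by (cases m) auto
    show ?thesis
    proof (cases l)
      case 0
      have "P1 n \<epsilon> \<inter> Y_set n \<epsilon> m' = {}" using disjoint_P1_Y by (auto simp: Y_def)
      then show ?thesis by (auto simp: m 0 X_set_0 X_set_Suc)
    next
      case (Suc l')
      then have "Y_set n \<epsilon> l' \<inter> Y_set n \<epsilon> m' = {}"
        using disjoint_Y that m by (auto simp: disjoint_family_on_def)
      then show ?thesis by (auto simp: m Suc X_set_Suc)
    qed
  qed
  then show ?thesis unfolding disjoint_family_on_def by (metis Int_commute linorder_neqE_nat)
qed

lemma compact_X_set: "compact (X_set n \<epsilon> l)"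
proof (induction l)
  case 0
  show ?case unfolding X_set_0 P1_def by (intro compact_continuous_image continuous_intros compact_Icc)
next
  case (Suc l)
  then have "compact (Y_set n \<epsilon> l)"
    unfolding Y_set.simps by (intro compact_continuous_image continuous_intros)
  then show ?case unfolding X_set_Suc by (intro compact_continuous_image continuous_intros)
qed

lemma compact_Y_set: "compact (Y_set n \<epsilon> l)"
  unfolding Y_set.simps by (intro compact_continuous_image continuous_intros compact_X_set)

lemma W_eq: "W_set n \<epsilon> = (L_int n - X) \<union> Y \<union> M_int n \<union> (P1 n \<epsilon> \<union> P2 n \<epsilon> \<union> P3 n \<epsilon>)"
  by (simp add: W_set_def X_def Y_def)

lemma W_borel: "W_set n \<epsilon> \<in> sets borel"
proof -
  have "X_set n \<epsilon> l \<in> sets borel" "Y_set n \<epsilon> l \<in> sets borel" for l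
    by (rule borel_compact[OF compact_X_set], rule borel_compact[OF compact_Y_set])
  then have "X \<in> sets borel" "Y \<in> sets borel"
    unfolding X_def Y_def by auto
  then show ?thesis
    unfolding W_eq L_int_def M_int_def P1_def P2_def P3_def by simp
qed

lemma interval_order:
  "- c < - e" "a \<le> e" "e \<le> 2 * a" "a + 2 * \<epsilon> < b" "b < d"
  using ends a_bounds N_ge_1 eps
proof -
  show e: "a \<le> e" using ends(4) a_bounds(3) by simp
  have "N * 1 \<le> N * (4 * a)" using ends(1) a_bounds(1) by simp
  then have "1 \<le> 4 * a" using N_ge_1 by (subst (asm) mult_le_cancel_left_pos) auto
  then show "e \<le> 2 * a" using ends(4) by simp
  have "0 < e" using e a_bounds(1) by linarith
  then have "1 * e < 2 * N * e" using a_bounds(1) N_ge_1 by (intro mult_strict_right_mono) auto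
  then show "- c < - e" using ends(6) by simp
  show "a + 2 * \<epsilon> < b" using eps ends(2) by simp
  show "b < d" using ends(2,3) a_bounds(3) N_ge_1 by simp
qed

lemma indicator_W:
  "indicator (W_set n \<epsilon>) y = indicator (L_int n - X) y + indicator Y y + indicator (M_int n) y
     + indicator (P1 n \<epsilon>) y + indicator (P2 n \<epsilon>) y + (indicator (P3 n \<epsilon>) y :: ennreal)"
proof -
  note o = interval_order a_bounds eps
  have s: "Y \<subseteq> {- a<..<0}" "P1 n \<epsilon> \<subseteq> {0<..<a}" by (fact Y_subset, fact P1_subset)
  have "(L_int n - X) \<inter> Y = {}" "((L_int n - X) \<union> Y) \<inter> M_int n = {}"
    "((L_int n - X) \<union> Y \<union> M_int n) \<inter> P1 n \<epsilon> = {}"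
    "((L_int n - X) \<union> Y \<union> M_int n \<union> P1 n \<epsilon>) \<inter> P2 n \<epsilon> = {}"
    "((L_int n - X) \<union> Y \<union> M_int n \<union> P1 n \<epsilon> \<union> P2 n \<epsilon>) \<inter> P3 n \<epsilon> = {}"
    using s o unfolding L_int_def M_int_def P2_def P3_def by fastforce+
  then show ?thesis
    unfolding W_eq Un_assoc[symmetric] by (simp add: indicator_add[symmetric] split: split_indicator)
qed

lemma indicator_L: "indicator (L_int n) y = indicator (L_int n - X) y + (indicator X y :: ennreal)"
  using X_subset by (auto split: split_indicator)

text \<open>Modulo integers \<open>X\<close> is \<open>P\<^sub>1 \<union> Y\<close>, so \<open>W\<close> has the orbit sum of \<open>L\<close>, \<open>M\<close>, \<open>P\<^sub>2\<close> and \<open>P\<^sub>3\<close> together. These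
are translates of \<open>[-a, a]\<close>, \<open>[b, 1 - a]\<close>, \<open>[a + 2\<epsilon>, b]\<close> and \<open>[a, a + 2\<epsilon>]\<close>.\<close>

lemma W_translation_tile: "AE x in lborel. \<exists>!k::int. x + of_int k \<in> W_set n \<epsilon>"
proof -
  let ?T = "orbit_sum (\<lambda>k x. x + of_int k)"
  note cong = orbit_sum_indicator_cong[OF int_action_translate]
  define m :: int where "m = 2 ^ (n - 2)"
  have m: "of_int m = N" by (simp add: m_def N_def)
  have XY: "?T (indicator X) x = ?T (indicator (P1 n \<epsilon>)) x + ?T (indicator Y) x" for x
  proof -
    have "?T (indicator X) x = ?T (indicator (P1 n \<epsilon> \<union> Y)) x"
    proof (rule cong[of "- m"])
      show "y + of_int (- m) \<in> X \<longleftrightarrow> y \<in> P1 n \<epsilon> \<union> Y" for y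
        using X_eq_translate[of y] by (simp add: m)
    qed
    also have "indicator (P1 n \<epsilon> \<union> Y) = (\<lambda>y. indicator (P1 n \<epsilon>) y + (indicator Y y :: ennreal))"
    proof -
      have "P1 n \<epsilon> \<inter> Y = {}" by (rule disjoint_P1_Y)
      then show ?thesis by (auto simp: fun_eq_iff split: split_indicator)
    qed
    finally show ?thesis by (simp add: orbit_sum_add)
  qed
  have L: "?T (indicator (L_int n)) x = ?T (indicator {- a..a}) x" for x
    by (rule cong[of "- m"]) (auto simp: L_int_def m ends(3,5))
  have M: "?T (indicator (M_int n)) x = ?T (indicator {b..1 - a}) x" for x
    by (rule cong[of "-1"]) (auto simp: M_int_def ends(2,4))
  have P3: "?T (indicator (P3 n \<epsilon>)) x = ?T (indicator {a..a + 2 * \<epsilon>}) x" for x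
    by (rule cong[of m]) (auto simp: P3_def m ends(3))
  have "?T (indicator (W_set n \<epsilon>)) x = ?T (\<lambda>y. indicator {- a..a} y + indicator {a..a + 2 * \<epsilon>} y
      + indicator (P2 n \<epsilon>) y + indicator {b..1 - a} y) x" for x
  proof -
    have "?T (indicator (L_int n)) x = ?T (indicator (L_int n - X)) x + ?T (indicator X) x"
      unfolding orbit_sum_add[symmetric] indicator_L[symmetric] ..
    moreover have "?T (indicator (W_set n \<epsilon>)) x = ?T (indicator (L_int n - X)) x + ?T (indicator Y) x
        + ?T (indicator (M_int n)) x + ?T (indicator (P1 n \<epsilon>)) x + ?T (indicator (P2 n \<epsilon>)) x
        + ?T (indicator (P3 n \<epsilon>)) x"
      unfolding orbit_sum_add[symmetric] indicator_W[symmetric] ..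
    ultimately have "?T (indicator (W_set n \<epsilon>)) x = ?T (indicator (L_int n)) x + ?T (indicator (P3 n \<epsilon>)) x
        + ?T (indicator (P2 n \<epsilon>)) x + ?T (indicator (M_int n)) x"
      unfolding XY by (simp only: add_ac)
    then show ?thesis by (simp only: orbit_sum_add L M P3)
  qed
  moreover have "AE x in lborel. ?T (\<lambda>y. indicator {- a..a} y + indicator {a..a + 2 * \<epsilon>} y
      + indicator (P2 n \<epsilon>) y + indicator {b..1 - a} y) x = ?T (indicator {- a..<- a + 1}) x"
  proof (rule orbit_sum_cong_AE[OF int_action_translate, of "{a, a + 2 * \<epsilon>, b, 1 - a}"])
    fix y :: real assume y: "y \<notin> {a, a + 2 * \<epsilon>, b, 1 - a}"
    have "indicator {- a..a} y + indicator {a..a + 2 * \<epsilon>} y + indicator {a + 2 * \<epsilon>..b} y + indicator {b..1 - a} y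
        = (indicator {- a..1 - a} y :: ennreal)"
      using y a_bounds eps ends(2) by (simp add: indicator_Icc_glue)
    also have "\<dots> = indicator {- a..<- a + 1} y"
      using y by (auto simp: indicator_def)
    finally show "indicator {- a..a} y + indicator {a..a + 2 * \<epsilon>} y + indicator (P2 n \<epsilon>) y + indicator {b..1 - a} y
        = (indicator {- a..<- a + 1} y :: ennreal)"
      by (simp add: P2_def)
  qed auto
  ultimately have "AE x in lborel. ?T (indicator (W_set n \<epsilon>)) x = 1"
    using orbit_sum_half_open[of "- a"] by simp
  then show ?thesis by eventually_elim (rule orbit_sum_indicator_ex1)
qed

text \<open>Modulo powers of 2 every \<open>X\<^sub>l\<close> is \<open>Y\<^sub>l\<close>, so \<open>W\<close> has the orbit sum of \<open>L\<close>, \<open>M\<close>, \<open>P\<^sub>1\<close>, \<open>P\<^sub>2\<close> and \<open>P\<^sub>3\<close>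
together. The first two become \<open>[-2a, -e]\<close> and \<open>[-e, -a]\<close>; the other three become
\<open>[a + 2\<epsilon>/2\<^sup>n, a + 2\<epsilon>]\<close>, \<open>[a + 2\<epsilon>, 2a]\<close> and \<open>[a, a + 2\<epsilon>/2\<^sup>n]\<close>.\<close>

lemma W_dilation_tile: "AE x in lborel. \<exists>!j::int. 2 powi j * x \<in> W_set n \<epsilon>"
proof -
  let ?D = "orbit_sum (\<lambda>j x. 2 powi j * x)"
  note cong = orbit_sum_indicator_cong[OF int_action_dilate]
  have pw: "(2::real) powi int m = 2 ^ m" for m by (simp add: power_int_def)
  have N0: "N > 0" using N_ge_1 by simp
  have XY: "?D (indicator X) x = ?D (indicator Y) x" for x
  proof -
    have "?D (indicator X) x = (\<Sum>l. ?D (indicator (X_set n \<epsilon> l)) x)"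
      unfolding X_def orbit_sum_suminf[symmetric] suminf_indicator[OF disjoint_X] ..
    also have "\<dots> = (\<Sum>l. ?D (indicator (Y_set n \<epsilon> l)) x)"
    proof (intro suminf_cong cong)
      fix l y
      show "2 powi int (n + l) * y \<in> X_set n \<epsilon> l \<longleftrightarrow> y \<in> Y_set n \<epsilon> l"
        unfolding Y_set.simps pw by (force simp: image_iff)
    qed
    also have "\<dots> = ?D (indicator Y) x"
      unfolding Y_def orbit_sum_suminf[symmetric] suminf_indicator[OF disjoint_Y] ..
    finally show ?thesis .
  qed
  have L: "?D (indicator (L_int n)) x = ?D (indicator {- (2 * a)..- e}) x" for x
  proof (rule cong[of "int (n - 1)"])
    fix y
    have "d = 2 * N * (2 * a)" using ends(1,3) by simp
    then have "L_int n = {2 * N * (- (2 * a))..2 * N * (- e)}" by (simp add: L_int_def ends(6))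
    moreover have "2 * N > 0" using N0 by simp
    ultimately show "2 powi int (n - 1) * y \<in> L_int n \<longleftrightarrow> y \<in> {- (2 * a)..- e}"
      by (simp only: pw two_powers atLeastAtMost_iff mult_le_cancel_left_pos)
  qed
  have P1: "?D (indicator (P1 n \<epsilon>)) x = ?D (indicator {a + 2 * (\<epsilon> / (4 * N))..a + 2 * \<epsilon>}) x" for x
    by (rule cong[of "-1"]) (auto simp: P1_def power_int_minus two_powers)
  have P3: "?D (indicator (P3 n \<epsilon>)) x = ?D (indicator {a..a + 2 * (\<epsilon> / (4 * N))}) x" for x
  proof (rule cong[of "int n"])
    fix y
    have "P3 n \<epsilon> = {4 * N * a..4 * N * (a + 2 * (\<epsilon> / (4 * N)))}"
      using N0 by (simp add: P3_def ends(1,3) distrib_left)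
    moreover have "4 * N > 0" using N0 by simp
    ultimately show "2 powi int n * y \<in> P3 n \<epsilon> \<longleftrightarrow> y \<in> {a..a + 2 * (\<epsilon> / (4 * N))}"
      by (simp only: pw two_powers atLeastAtMost_iff mult_le_cancel_left_pos)
  qed
  let ?F = "\<lambda>y. indicator {- (2 * a)..- e} y + indicator (M_int n) y + indicator {a..a + 2 * (\<epsilon> / (4 * N))} y
      + indicator {a + 2 * (\<epsilon> / (4 * N))..a + 2 * \<epsilon>} y + indicator (P2 n \<epsilon>) y :: ennreal"
  have "?D (indicator (W_set n \<epsilon>)) x = ?D ?F x" for x
  proof -
    have "?D (indicator (L_int n)) x = ?D (indicator (L_int n - X)) x + ?D (indicator X) x"
      unfolding orbit_sum_add[symmetric] indicator_L[symmetric] ..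
    moreover have "?D (indicator (W_set n \<epsilon>)) x = ?D (indicator (L_int n - X)) x + ?D (indicator Y) x
        + ?D (indicator (M_int n)) x + ?D (indicator (P1 n \<epsilon>)) x + ?D (indicator (P2 n \<epsilon>)) x
        + ?D (indicator (P3 n \<epsilon>)) x"
      unfolding orbit_sum_add[symmetric] indicator_W[symmetric] ..
    ultimately have "?D (indicator (W_set n \<epsilon>)) x = ?D (indicator (L_int n)) x + ?D (indicator (M_int n)) x
        + ?D (indicator (P3 n \<epsilon>)) x + ?D (indicator (P1 n \<epsilon>)) x + ?D (indicator (P2 n \<epsilon>)) x"
      unfolding XY by (simp only: add_ac)
    then show ?thesis by (simp only: orbit_sum_add L P1 P3)
  qed
  moreover have "AE x in lborel. ?D ?F x = ?D (indicator {y. a \<le> \<bar>y\<bar> \<and> \<bar>y\<bar> < 2 * a}) x"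
  proof (rule orbit_sum_cong_AE[OF int_action_dilate, of "{- (2 * a), - e, a + 2 * (\<epsilon> / (4 * N)), a + 2 * \<epsilon>, b}"])
    fix y :: real assume y: "y \<notin> {- (2 * a), - e, a + 2 * (\<epsilon> / (4 * N)), a + 2 * \<epsilon>, b}"
    have "0 < \<epsilon> / (4 * N)" using eps_N by simp
    then have pos: "indicator {a..a + 2 * (\<epsilon> / (4 * N))} y + indicator {a + 2 * (\<epsilon> / (4 * N))..a + 2 * \<epsilon>} y
        + indicator {a + 2 * \<epsilon>..b} y = (indicator {a..b} y :: ennreal)"
      using y eps_N(3) eps interval_order(4) by (simp add: indicator_Icc_glue)
    have neg: "indicator {- (2 * a)..- e} y + indicator {- e..- a} y = (indicator {- (2 * a)..- a} y :: ennreal)"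
      using y interval_order(2,3) by (simp add: indicator_Icc_glue)
    have "?F y = indicator {- (2 * a)..- a} y + indicator {a..b} y"
      unfolding neg[symmetric] pos[symmetric] P2_def M_int_def by (simp only: add_ac)
    also have "\<dots> = indicator {y. a \<le> \<bar>y\<bar> \<and> \<bar>y\<bar> < 2 * a} y"
    proof (cases "y < 0")
      case True
      then show ?thesis using y a_bounds(1) by (auto simp: indicator_def)
    next
      case False
      then show ?thesis using y a_bounds(1) ends(2) by (auto simp: indicator_def)
    qed
    finally show "?F y = indicator {y. a \<le> \<bar>y\<bar> \<and> \<bar>y\<bar> < 2 * a} y" .
  qed auto
  moreover have "AE x in lborel. ?D (indicator {y. a \<le> \<bar>y\<bar> \<and> \<bar>y\<bar> < 2 * a}) x = 1"
    using AE_lborel_singleton[of 0]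
  proof eventually_elim
    case (elim x)
    then show ?case unfolding orbit_sum_def
      using count_space_indicator_ex1[OF ex1_dilate_annulus[OF a_bounds(1)]] by blast
  qed
  ultimately have "AE x in lborel. ?D (indicator (W_set n \<epsilon>)) x = 1" by auto
  then show ?thesis by eventually_elim (rule orbit_sum_indicator_ex1)
qed

lemma W_bounded: "bounded (W_set n \<epsilon>)"
proof -
  have "W_set n \<epsilon> \<subseteq> L_int n \<union> {- a..0} \<union> M_int n \<union> ({0..a} \<union> P2 n \<epsilon> \<union> P3 n \<epsilon>)"
    unfolding W_eq using Y_subset P1_subset less_imp_le by (intro Un_mono) auto
  moreover have "bounded \<dots>"
    unfolding L_int_def M_int_def P2_def P3_def
    by (intro bounded_Un[THEN iffD2] conjI bounded_closed_interval)
  ultimately show ?thesis by (rule bounded_subset[rotated])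
qed

lemma X_set_nonempty: "X_set n \<epsilon> l \<noteq> {}"
proof (induction l)
  case 0
  have "a / 2 + \<epsilon> \<in> P1 n \<epsilon>" using eps_N by (simp add: P1_def)
  then show ?case by (auto simp: X_set_0)
next
  case (Suc l)
  then show ?case by (simp add: X_set_Suc Y_set.simps)
qed

lemma W_islimpt: "0 islimpt W_set n \<epsilon>"
  unfolding islimpt_approachable
proof (intro allI impI)
  fix r :: real assume "r > 0"
  obtain l where l: "(1 / 2) ^ l < r / a"
    using real_arch_pow_inv[of "r / a" "1/2"] \<open>r > 0\<close> a_bounds(1) by auto
  then have al: "a / 2 ^ l < r" using a_bounds(1) by (simp add: power_divide field_simps)
  obtain y where y: "y \<in> Y_set n \<epsilon> l" using X_set_nonempty[of l] by (auto simp: Y_set.simps)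
  then have "- a / 2 ^ l < y" "y < - a / 2 ^ Suc l" by (rule Y_set_location)+
  then have "y < 0" "\<bar>y\<bar> < r" using al a_scale_bounds(2)[of "Suc l"] by auto
  moreover have "y \<in> W_set n \<epsilon>" using y by (auto simp: W_eq Y_def)
  ultimately show "\<exists>x'\<in>W_set n \<epsilon>. x' \<noteq> 0 \<and> dist x' 0 < r" by (intro bexI[of _ y]) auto
qed

end

theorem theorem20:
  fixes n :: nat and \<epsilon> :: real
  assumes "n \<ge> 2" and "0 < \<epsilon>" and "\<epsilon> < a_end n / 2"
  shows "wavelet_set (W_set n \<epsilon>) \<and> bounded (W_set n \<epsilon>) \<and> 0 islimpt W_set n \<epsilon>"
proof -
  interpret W_parameters n \<epsilon> using assms by unfold_locales
  interpret wavelet_tile "W_set n \<epsilon>"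
    using W_borel W_translation_tile W_bounded W_dilation_tile
    by unfold_locales (simp_all only: trans_tile_def simp_thms)
  show ?thesis using wavelet_set_tile W_bounded W_islimpt by blast
qed

end
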